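(* Let $n\ge 2$ and $d\ge 3$, and let $V$ be a complex vector space of dimension $n$. Every form $F\in S^dV$ with an equipotent apolar generator is a limit of direct sums; conversely, every concise form $F\in S^dV$ which is a limit of direct sums has an equipotent apolar generator. In particular, $\mathrm{ApoEqu}\cap\mathrm{Con}=\overline{\mathrm{DirSum}}\cap\mathrm{Con}$ in $S^dV$.
   Context: Fix a basis $x_1,\dots,x_n$ of $V$, let $S=\mathbb{C}[x_1,\dots,x_n]=\bigoplus_d S^dV$ and let $T=\mathbb{C}[\alpha_1,\dots,\alpha_n]$ be the dual ring, acting on $S$ by letting $\alpha_i$ act as $\partial/\partial x_i$; write $\Theta\circ F$ for this action. The apolar ideal of a (nonzero) form $F$ is $F^\perp=\{\Theta\in T:\Theta\circ F=0\}$. A form $F\in S^dV$ is a direct sum if there are subspaces $V_1,V_2\subset V$ with $V=V_1\oplus V_2$ and nonzero $F_1\in S^dV_1$, $F_2\in S^dV_2$ such that $F=F_1+F_2$. $\mathrm{DirSum}\subset S^dV$ is the set of direct sums, and a limit of direct sums is an element of the closure $\overline{\mathrm{DirSum}}$ in $S^dV$. With $\mathfrak m=\langle\alpha_1,\dots,\alpha_n\rangle$, a form $F$ of degree $d$ has an equipotent apolar generator if $F^\perp$ has a minimal generator of degree $d$, i.e. $(F^\perp/\mathfrak m F^\perp)_d\neq0$. $\mathrm{ApoEqu}\subset S^dV$ is the set of forms with an equipotent apolar generator. A form $F\in S^dV$ is concise if $F\in S^dW$ with $W\subset V$ a subspace implies $W=V$ (it cannot be written in fewer variables). $\mathrm{Con}\subset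 S^dV$ is the set of concise forms. *)

theory Defs
  imports "HOL-Analysis.Analysis" "HOL-Analysis.Finite_Function_Topology"
begin

text \<open>
  The variables are indexed by a finite type \<open>'n\<close>, so the dimension of \<open>V\<close> is
  \<open>CARD('n)\<close>. A polynomial maps monomials (exponent vectors) to coefficients; the same type
  carries \<open>S\<close> and its dual ring \<open>T\<close>. The ring structure comes from \<open>Poly_Mapping\<close>, the
  norm topology (sum of the absolute values of the coefficients) from
  \<open>Finite_Function_Topology\<close>.
\<close>

type_synonym 'n monom = "'n \<Rightarrow>\<^sub>0 nat"
type_synonym 'n cpoly = "'n monom \<Rightarrow>\<^sub>0 complex"

definition var :: "'n \<Rightarrow> 'n cpoly" where
  "var i = Poly_Mapping.single (Poly_Mapping.single i 1) 1"

definition cscale :: "complex \<Rightarrow> 'n cpoly \<Rightarrow> 'n cpoly" where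
  "cscale c F = Poly_Mapping.single 0 c * F"

lemma lookup_cscale [simp]: "Poly_Mapping.lookup (cscale c F) m = c * Poly_Mapping.lookup F m"
  by (simp add: cscale_def flip: mult_map_scale_conv_mult) (auto simp: map.rep_eq when_def)

global_interpretation cvs: vector_space cscale
  by unfold_locales (auto intro!: poly_mapping_eqI simp: lookup_add algebra_simps)


section \<open>Forms and symmetric powers of subspaces\<close>

definition monom_deg :: "'n::finite monom \<Rightarrow> nat" where
  "monom_deg m = (\<Sum>i\<in>UNIV. Poly_Mapping.lookup m i)"

text \<open>The degree \<open>d\<close> component of the polynomial ring, used both for \<open>S\<^sup>d V\<close> and for \<open>T\<^sub>d\<close>.\<close>

definition forms :: "nat \<Rightarrow> 'n::finite cpoly set" where
  "forms d = {F. \<forall>m\<in>Poly_Mapping.keys F. monom_deg m = d}"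

text \<open>The vector space \<open>V\<close>, with basis the variables.\<close>

definition linear_forms :: "'n cpoly set" where
  "linear_forms = cvs.span (range var)"

text \<open>\<open>S\<^sup>d W\<close> inside \<open>S\<^sup>d V\<close>, spanned by the \<open>d\<close>-fold products of elements of \<open>W\<close>.\<close>

definition Sym :: "nat \<Rightarrow> 'n cpoly set \<Rightarrow> 'n cpoly set" where
  "Sym d W = cvs.span {\<Prod>i<d. l i |l. \<forall>i<d. l i \<in> W}"


section \<open>The apolarity action\<close>

text \<open>
  \<open>apply_diff \<Theta> F\<close> is \<open>\<Theta> \<circ> F\<close>. The operator of exponent vector \<open>m\<close> sends the monomial of exponent
  vector \<open>e\<close> to the one of exponent vector \<open>e - m\<close>, multiplied by the product over \<open>i\<close> of
  \<open>e\<^sub>i (e\<^sub>i - 1) \<cdots> (e\<^sub>i - m\<^sub>i + 1)\<close>. The truncated subtraction in \<open>e - m\<close> is harmless since that factor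
  is zero as soon as some \<open>m\<^sub>i > e\<^sub>i\<close>. The lemmas below show that this is the ring action in which
  \<open>var i\<close> acts as the partial derivative \<open>pderiv_var i\<close>.
\<close>

definition diff_coeff :: "'n::finite monom \<Rightarrow> 'n monom \<Rightarrow> complex" where
  "diff_coeff m e = (\<Prod>i\<in>UNIV. \<Prod>j<Poly_Mapping.lookup m i. of_nat (Poly_Mapping.lookup e i) - of_nat j)"

definition apply_diff :: "'n::finite cpoly \<Rightarrow> 'n cpoly \<Rightarrow> 'n cpoly" where
  "apply_diff \<Theta> F = (\<Sum>m\<in>Poly_Mapping.keys \<Theta>. \<Sum>e\<in>Poly_Mapping.keys F.
     Poly_Mapping.single (e - m)
       (Poly_Mapping.lookup \<Theta> m * Poly_Mapping.lookup F e * diff_coeff m e))"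

definition pderiv_var :: "'n \<Rightarrow> 'n cpoly \<Rightarrow> 'n cpoly" where
  "pderiv_var i F = (\<Sum>e\<in>Poly_Mapping.keys F.
     Poly_Mapping.single (e - Poly_Mapping.single i 1)
       (of_nat (Poly_Mapping.lookup e i) * Poly_Mapping.lookup F e))"

lemma apply_diff_superset:
  assumes "finite A" "finite B" "Poly_Mapping.keys \<Theta> \<subseteq> A" "Poly_Mapping.keys F \<subseteq> B"
  shows "apply_diff \<Theta> F = (\<Sum>m\<in>A. \<Sum>e\<in>B. Poly_Mapping.single (e - m)
       (Poly_Mapping.lookup \<Theta> m * Poly_Mapping.lookup F e * diff_coeff m e))"
proof -
  have "apply_diff \<Theta> F = (\<Sum>m\<in>Poly_Mapping.keys \<Theta>. \<Sum>e\<in>B. Poly_Mapping.single (e - m)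
       (Poly_Mapping.lookup \<Theta> m * Poly_Mapping.lookup F e * diff_coeff m e))"
    unfolding apply_diff_def using assms
    by (intro sum.cong refl sum.mono_neutral_left) (auto simp: in_keys_iff)
  also have "\<dots> = (\<Sum>m\<in>A. \<Sum>e\<in>B. Poly_Mapping.single (e - m)
       (Poly_Mapping.lookup \<Theta> m * Poly_Mapping.lookup F e * diff_coeff m e))"
    using assms by (intro sum.mono_neutral_left) (auto simp: in_keys_iff)
  finally show ?thesis .
qed

lemma apply_diff_add_left: "apply_diff (\<Theta> + \<Psi>) F = apply_diff \<Theta> F + apply_diff \<Psi> F"
proof -
  define A where "A = Poly_Mapping.keys \<Theta> \<union> Poly_Mapping.keys \<Psi>"
  have A: "finite A" "Poly_Mapping.keys \<Theta> \<subseteq> A" "Poly_Mapping.keys \<Psi> \<subseteq> A"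
    "Poly_Mapping.keys (\<Theta> + \<Psi>) \<subseteq> A"
    using keys_add[of \<Theta> \<Psi>] by (auto simp: A_def)
  note e = apply_diff_superset[OF A(1) finite_keys _ order_refl]
  show ?thesis
    unfolding e[OF A(2)] e[OF A(3)] e[OF A(4)]
    by (simp add: lookup_add single_add sum.distrib algebra_simps)
qed

lemma apply_diff_add_right: "apply_diff \<Theta> (F + G) = apply_diff \<Theta> F + apply_diff \<Theta> G"
proof -
  define A where "A = Poly_Mapping.keys F \<union> Poly_Mapping.keys G"
  have A: "finite A" "Poly_Mapping.keys F \<subseteq> A" "Poly_Mapping.keys G \<subseteq> A"
    "Poly_Mapping.keys (F + G) \<subseteq> A"
    using keys_add[of F G] by (auto simp: A_def)
  note e = apply_diff_superset[OF finite_keys A(1) order_refl]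
  show ?thesis
    unfolding e[OF A(2)] e[OF A(3)] e[OF A(4)]
    by (simp add: lookup_add single_add sum.distrib algebra_simps)
qed

lemma apply_diff_zero [simp]: "apply_diff 0 F = 0" "apply_diff \<Theta> 0 = 0"
  by (simp_all add: apply_diff_def)

lemma apply_diff_single:
  "apply_diff (Poly_Mapping.single m a) (Poly_Mapping.single e c)
     = Poly_Mapping.single (e - m) (a * c * diff_coeff m e)"
  by (subst apply_diff_superset[of "{m}" "{e}"]) auto

lemma cpoly_induct [case_names zero single_add]:
  fixes F :: "'n cpoly"
  assumes "P 0" and "\<And>m c G. P G \<Longrightarrow> P (Poly_Mapping.single m c + G)"
  shows "P F"
proof (induction F rule: update_induct)
  case const
  then show ?case using assms(1) by simp
next
  case (update F m c)
  have "Poly_Mapping.update m c F = Poly_Mapping.single m c + F"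
    using update(1) by (intro poly_mapping_eqI) (auto simp: lookup_update lookup_add lookup_single when_def in_keys_iff)
  then show ?case using assms(2) update by simp
qed

lemma diff_coeff_add: "diff_coeff (m + m') e = diff_coeff m (e - m') * diff_coeff m' e"
proof -
  have *: "(\<Prod>j<p + q. of_nat r - of_nat j :: complex)
      = (\<Prod>j<p. of_nat (r - q) - of_nat j) * (\<Prod>j<q. of_nat r - of_nat j)" for p q r :: nat
  proof (cases "q \<le> r")
    case True
    show ?thesis
    proof (induction p)
      case (Suc p)
      have "of_nat (r - q) - of_nat p = (of_nat r - of_nat (p + q) :: complex)"
        using True by (simp add: of_nat_diff)
      then show ?case using Suc.IH by (simp add: mult_ac)
    qed simp
  next
    case False
    then have "(\<Prod>j<q. of_nat r - of_nat j :: complex) = 0"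
      and "(\<Prod>j<p + q. of_nat r - of_nat j :: complex) = 0"
      by (auto intro!: prod_zero bexI[of _ r])
    then show ?thesis by (simp only: mult_zero_right)
  qed
  show ?thesis
    by (simp add: diff_coeff_def lookup_add lookup_minus * prod.distrib)
qed

theorem apply_diff_one [simp]: "apply_diff 1 F = F"
proof (induction F rule: cpoly_induct)
  case (single_add m c G)
  have "apply_diff 1 (Poly_Mapping.single m c) = Poly_Mapping.single m c"
    using apply_diff_single[of 0 1 m c] by (simp add: diff_coeff_def)
  then show ?case using single_add by (simp add: apply_diff_add_right)
qed simp

theorem apply_diff_mult: "apply_diff (\<Theta> * \<Psi>) F = apply_diff \<Theta> (apply_diff \<Psi> F)"
proof (induction F rule: cpoly_induct)
  case (single_add e c G)
  have "apply_diff (\<Theta> * \<Psi>) (Poly_Mapping.single e c)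
      = apply_diff \<Theta> (apply_diff \<Psi> (Poly_Mapping.single e c))"
  proof (induction \<Psi> rule: cpoly_induct)
    case (single_add m' b \<Psi>)
    have "apply_diff (\<Theta> * Poly_Mapping.single m' b) (Poly_Mapping.single e c)
        = apply_diff \<Theta> (apply_diff (Poly_Mapping.single m' b) (Poly_Mapping.single e c))"
    proof (induction \<Theta> rule: cpoly_induct)
      case (single_add m a \<Theta>)
      have "e - (m + m') = e - m' - m"
        by (simp add: add.commute diff_diff_add)
      then have "apply_diff (Poly_Mapping.single m a * Poly_Mapping.single m' b) (Poly_Mapping.single e c)
        = apply_diff (Poly_Mapping.single m a) (apply_diff (Poly_Mapping.single m' b) (Poly_Mapping.single e c))"
        by (simp only: mult_single apply_diff_single diff_coeff_add) (simp add: mult_ac)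
      then show ?case using single_add
        by (simp add: apply_diff_add_left distrib_right)
    qed simp
    then show ?case using single_add
      by (simp add: apply_diff_add_left apply_diff_add_right distrib_left)
  qed simp
  then show ?case using single_add by (simp add: apply_diff_add_right)
qed simp

theorem apply_diff_var: "apply_diff (var i) F = pderiv_var i F"
proof -
  have "diff_coeff (Poly_Mapping.single i 1) e = of_nat (Poly_Mapping.lookup e i)" for e :: "'a monom"
  proof -
    have "diff_coeff (Poly_Mapping.single i 1) e
      = (\<Prod>k\<in>UNIV. if k = i then of_nat (Poly_Mapping.lookup e k) else 1)"
      unfolding diff_coeff_def by (intro prod.cong) (auto simp: lookup_single when_def)
    then show ?thesis by simp
  qed
  then show ?thesis
    by (simp add: apply_diff_def pderiv_var_def var_def mult_ac)
qed


section \<open>Apolar ideals and equipotent apolar generators\<close>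

definition apolar_ideal :: "'n::finite cpoly \<Rightarrow> 'n cpoly set" where
  "apolar_ideal F = {\<Theta>. apply_diff \<Theta> F = 0}"

text \<open>
  Ideals of a commutative ring are its submodules, so \<open>module.span (*)\<close> is the ideal generated by a
  set.
\<close>

definition max_ideal :: "'n cpoly set" where
  "max_ideal = module.span (*) (range var)"

definition ideal_mult :: "'a::comm_ring_1 set \<Rightarrow> 'a set \<Rightarrow> 'a set" where
  "ideal_mult I J = module.span (*) {a * b |a b. a \<in> I \<and> b \<in> J}"

text \<open>
  The degree \<open>d\<close> component of the quotient \<open>I / J\<close> of homogeneous ideals \<open>J \<subseteq> I\<close>: the cosets
  of the degree \<open>d\<close> elements of \<open>I\<close>. Its zero element is the coset \<open>J\<close>.
\<close>

definition quotient_component :: "'n::finite cpoly set \<Rightarrow> 'n cpoly set \<Rightarrow> nat \<Rightarrow> 'n cpoly set set" where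
  "quotient_component I J d = (\<lambda>\<Theta>. (+) \<Theta> ` J) ` (I \<inter> forms d)"

definition ApoEqu :: "nat \<Rightarrow> 'n::finite cpoly set" where
  "ApoEqu d = {F \<in> forms d. quotient_component (apolar_ideal F)
     (ideal_mult max_ideal (apolar_ideal F)) d \<noteq> {ideal_mult max_ideal (apolar_ideal F)}}"

lemma module_mult: "module ((*) :: 'a::comm_ring_1 \<Rightarrow> 'a \<Rightarrow> 'a)"
  by unfold_locales (auto simp: algebra_simps)

lemma subspace_apolar_ideal: "module.subspace (*) (apolar_ideal F)"
  by (auto simp: module.subspace_def[OF module_mult] apolar_ideal_def apply_diff_add_left apply_diff_mult)

lemma ApoEqu_iff:
  "F \<in> ApoEqu d \<longleftrightarrow> F \<in> forms d \<and>
     (\<exists>\<Theta> \<in> apolar_ideal F \<inter> forms d. \<Theta> \<notin> ideal_mult max_ideal (apolar_ideal F))"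
proof -
  let ?J = "ideal_mult max_ideal (apolar_ideal F)"
  let ?A = "apolar_ideal F \<inter> forms d"
  have sub: "module.subspace (*) ?J"
    unfolding ideal_mult_def by (rule module.subspace_span[OF module_mult])
  have *: "(+) \<Theta> ` ?J = ?J \<longleftrightarrow> \<Theta> \<in> ?J" for \<Theta>
  proof
    assume "(+) \<Theta> ` ?J = ?J"
    moreover have "\<Theta> + 0 \<in> (+) \<Theta> ` ?J"
      by (rule imageI) (rule module.subspace_0[OF module_mult sub])
    ultimately show "\<Theta> \<in> ?J" by simp
  next
    assume \<Theta>: "\<Theta> \<in> ?J"
    show "(+) \<Theta> ` ?J = ?J"
    proof
      show "(+) \<Theta> ` ?J \<subseteq> ?J"
        by (rule image_subsetI) (rule module.subspace_add[OF module_mult sub \<Theta>])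
      show "?J \<subseteq> (+) \<Theta> ` ?J"
      proof
        fix x assume "x \<in> ?J"
        then have "x - \<Theta> \<in> ?J"
          using \<Theta> by (rule module.subspace_diff[OF module_mult sub])
        moreover have "x = \<Theta> + (x - \<Theta>)" by simp
        ultimately show "x \<in> (+) \<Theta> ` ?J" by (rule rev_image_eqI)
      qed
    qed
  qed
  have "0 \<in> ?A"
    by (simp add: apolar_ideal_def forms_def)
  then have "?A \<noteq> {}" by fast
  moreover have "f ` A \<noteq> {c} \<longleftrightarrow> (\<exists>x\<in>A. f x \<noteq> c)" if "A \<noteq> {}"
    for f :: "'a cpoly \<Rightarrow> 'a cpoly set" and A c
    using that by auto
  ultimately have "(\<lambda>\<Theta>. (+) \<Theta> ` ?J) ` ?A \<noteq> {?J} \<longleftrightarrow> (\<exists>\<Theta>\<in>?A. (+) \<Theta> ` ?J \<noteq> ?J)"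
    by presburger
  then show ?thesis
    by (simp only: ApoEqu_def quotient_component_def mem_Collect_eq *)
qed


section \<open>Direct sums and concise forms\<close>

definition direct_decomp :: "'n cpoly set \<Rightarrow> 'n cpoly set \<Rightarrow> bool" where
  "direct_decomp V\<^sub>1 V\<^sub>2 \<longleftrightarrow> cvs.subspace V\<^sub>1 \<and> cvs.subspace V\<^sub>2 \<and>
     {a + b |a b. a \<in> V\<^sub>1 \<and> b \<in> V\<^sub>2} = linear_forms \<and> V\<^sub>1 \<inter> V\<^sub>2 = {0}"

definition DirSum :: "nat \<Rightarrow> 'n::finite cpoly set" where
  "DirSum d = {F \<in> forms d. \<exists>V\<^sub>1 V\<^sub>2 F\<^sub>1 F\<^sub>2. direct_decomp V\<^sub>1 V\<^sub>2 \<and>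
     F\<^sub>1 \<in> Sym d V\<^sub>1 \<and> F\<^sub>1 \<noteq> 0 \<and> F\<^sub>2 \<in> Sym d V\<^sub>2 \<and> F\<^sub>2 \<noteq> 0 \<and> F = F\<^sub>1 + F\<^sub>2}"

definition Con :: "nat \<Rightarrow> 'n::finite cpoly set" where
  "Con d = {F \<in> forms d. \<forall>W. cvs.subspace W \<and> W \<subseteq> linear_forms \<and> F \<in> Sym d W
     \<longrightarrow> W = linear_forms}"


section \<open>Consistency of the two descriptions of \<open>S\<^sup>d V\<close>, and closedness\<close>

lemma subspace_forms: "cvs.subspace (forms d)"
  unfolding forms_def
  by (intro cvs.subspaceI) (auto simp: in_keys_iff lookup_add)

lemma forms_mult: "F \<in> forms p \<Longrightarrow> G \<in> forms q \<Longrightarrow> F * G \<in> forms (p + q)"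
  using keys_mult[of F G]
  by (fastforce simp: forms_def monom_deg_def lookup_add sum.distrib)

lemma forms_one: "1 \<in> forms 0"
  by (simp add: forms_def monom_deg_def)

lemma linear_forms_subset: "linear_forms \<subseteq> forms 1"
  unfolding linear_forms_def
proof (rule cvs.span_minimal[OF _ subspace_forms])
  show "range var \<subseteq> (forms 1 :: 'a cpoly set)"
    by (auto simp: forms_def var_def monom_deg_def lookup_single when_def)
qed

lemma single_in_Sym:
  "Poly_Mapping.single m c \<in> (Sym (monom_deg m) linear_forms :: 'n::finite cpoly set)"
proof -
  have "\<exists>l. (\<forall>i<d. l i \<in> linear_forms) \<and> (\<Prod>i<d. l i) = (Poly_Mapping.single m 1 :: 'n cpoly)"
    if "monom_deg m = d" for d
    using that
  proof (induction d arbitrary: m)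
    case 0
    then have "m = 0" by (auto simp: monom_deg_def intro: poly_mapping_eqI)
    then show ?case by simp
  next
    case (Suc d)
    then obtain k where k: "Poly_Mapping.lookup m k > 0"
      by (metis (no_types, lifting) Zero_not_Suc bot_nat_0.not_eq_extremum monom_deg_def sum.neutral)
    define m' where "m' = m - Poly_Mapping.single k 1"
    have m: "m = m' + Poly_Mapping.single k 1"
      using k by (auto intro!: poly_mapping_eqI simp: m'_def lookup_add lookup_minus lookup_single when_def)
    then have "monom_deg m' = d"
      using Suc.prems by (simp add: monom_deg_def lookup_add lookup_single sum.distrib when_def)
    then obtain l where l: "\<forall>i<d. l i \<in> linear_forms" "(\<Prod>i<d. l i) = (Poly_Mapping.single m' 1 :: 'n cpoly)"
      using Suc.IH by blast
    have "var k \<in> (linear_forms :: 'n cpoly set)"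
      by (simp add: linear_forms_def cvs.span_base)
    moreover have "(\<Prod>i<d. (l(d := var k)) i) = (\<Prod>i<d. l i)"
      by (intro prod.cong) auto
    then have "(\<Prod>i<Suc d. (l(d := var k)) i) = Poly_Mapping.single m 1"
      using l(2) by (simp add: var_def mult_single m)
    ultimately show ?case
      using l(1) by (intro exI[of _ "l(d := var k)"]) (auto simp: less_Suc_eq)
  qed
  then obtain l where "\<forall>i<monom_deg m. l i \<in> linear_forms"
    and "Poly_Mapping.single m 1 = (\<Prod>i<monom_deg m. l i :: 'n cpoly)" by metis
  then have "Poly_Mapping.single m 1 \<in> (Sym (monom_deg m) linear_forms :: 'n cpoly set)"
    unfolding Sym_def by (intro cvs.span_base) blast
  then have "cscale c (Poly_Mapping.single m 1) \<in> (Sym (monom_deg m) linear_forms :: 'n cpoly set)"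
    unfolding Sym_def by (rule cvs.span_scale)
  then show ?thesis by (simp add: cscale_def mult_single)
qed

theorem Sym_linear_forms: "Sym d linear_forms = forms d"
proof
  have "(\<Prod>i<d. l i) \<in> forms d" if "\<forall>i<d. l i \<in> linear_forms" for l :: "nat \<Rightarrow> 'a cpoly"
    using that
  proof (induction d)
    case (Suc d)
    then have "(\<Prod>i<d. l i) * l d \<in> forms (d + 1)"
      using linear_forms_subset by (intro forms_mult) auto
    then show ?case by simp
  qed (simp add: forms_one)
  then show "Sym d linear_forms \<subseteq> (forms d :: 'a cpoly set)"
    unfolding Sym_def by (intro cvs.span_minimal[OF _ subspace_forms]) auto
next
  show "forms d \<subseteq> (Sym d linear_forms :: 'a cpoly set)"
  proof
    fix F :: "'a cpoly"
    assume F: "F \<in> forms d"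
    have "F = (\<Sum>m\<in>Poly_Mapping.keys F. Poly_Mapping.single m (Poly_Mapping.lookup F m))"
    proof (rule poly_mapping_eqI)
      fix k
      show "Poly_Mapping.lookup F k = Poly_Mapping.lookup
        (\<Sum>m\<in>Poly_Mapping.keys F. Poly_Mapping.single m (Poly_Mapping.lookup F m)) k"
        by (simp add: lookup_sum lookup_single when_def in_keys_iff)
    qed
    also have "\<dots> \<in> Sym d linear_forms"
      unfolding Sym_def
    proof (rule cvs.span_sum)
      fix m assume "m \<in> Poly_Mapping.keys F"
      then have "monom_deg m = d" using F by (auto simp: forms_def)
      then show "Poly_Mapping.single m (Poly_Mapping.lookup F m)
          \<in> cvs.span {\<Prod>i<d. l i |l. \<forall>i<d. l i \<in> linear_forms}"
        using single_in_Sym[of m] by (simp add: Sym_def)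
    qed
    finally show "F \<in> Sym d linear_forms" .
  qed
qed

lemma dist_lookup_le:
  fixes F G :: "'n cpoly"
  shows "dist (Poly_Mapping.lookup F m) (Poly_Mapping.lookup G m) \<le> dist F G"
proof (cases "m \<in> Poly_Mapping.keys F \<union> Poly_Mapping.keys G")
  case True
  then show ?thesis
    unfolding dist_poly_mapping_def by (intro member_le_sum) auto
qed (simp add: in_keys_iff)

text \<open>
  Hence the closure of a subset of \<open>forms d\<close> in the whole polynomial ring is its closure in
  \<open>S\<^sup>d V\<close>.
\<close>

theorem closed_forms: "closed (forms d :: 'n::finite cpoly set)"
proof -
  have "F \<in> forms d" if "\<forall>n. f n \<in> forms d" "f \<longlonglongrightarrow> F" for f and F :: "'n cpoly"
    unfolding forms_def mem_Collect_eq
  proof (intro ballI, rule ccontr)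
    fix m assume m: "m \<in> Poly_Mapping.keys F" "monom_deg m \<noteq> d"
    then have z: "Poly_Mapping.lookup (f n) m = 0" for n
      using that(1) by (force simp: forms_def in_keys_iff)
    have "norm (Poly_Mapping.lookup F m) \<le> dist (f n) F" for n
      using dist_lookup_le[of "f n" m F] by (simp add: z)
    moreover have "(\<lambda>n. dist (f n) F) \<longlonglongrightarrow> 0"
      using that(2) by (rule iffD1[OF tendsto_dist_iff])
    ultimately have "norm (Poly_Mapping.lookup F m) \<le> 0"
      by (intro LIMSEQ_le_const) auto
    then show False using m(1) by (simp add: in_keys_iff)
  qed
  then show ?thesis unfolding closed_sequential_limits by blast
qed

end

theory Submission
  imports Defs "HOL-Computational_Algebra.Fundamental_Theorem_Algebra"
begin

text \<open>
  The link between the two sides of the theorem is linear algebra of the Hessian \<open>H\<close> of \<open>F\<close>, a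
  symmetric matrix of forms. A scalar matrix \<open>A\<close> always satisfies \<open>A\<^sup>T H = H A\<close>; the point is
  whether some non-scalar \<open>A\<close> does. Such matrices (\<open>sym_mats F\<close>) are exactly those for which the
  vector field \<open>A\<^sup>T \<nabla>F\<close> is again the gradient of a form \<open>G\<close>; in terms of the symmetric multilinear
  form attached to \<open>F\<close>, they are the self-adjoint maps. Two facts make this condition useful: it is
  inherited by all polynomials in \<open>A\<close>, and it is closed in the pair \<open>(A, F)\<close>.

  \<^bold>\<open>Apolarity.\<close> Under the perfect pairing between forms of degree \<open>d\<close>, the annihilator of the degree
  \<open>d\<close> part of \<open>F\<^sup>\<bottom>\<close> is spanned by \<open>F\<close>, while the annihilator of the degree \<open>d\<close> part of \<open>m F\<^sup>\<bottom>\<close>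
  consists of the forms \<open>G\<close> all of whose first derivatives are linear combinations of those of \<open>F\<close>.
  So an equipotent apolar generator means that there is such a \<open>G\<close> that is not a multiple of \<open>F\<close>; the
  coefficients of its derivatives form a non-scalar matrix in \<open>sym_mats F\<close> (\<open>ApoEqu_nonscalar\<close>).
  Conversely a non-scalar matrix yields a \<open>G\<close>, and if \<open>F\<close> is concise its first derivatives are
  linearly independent, so that \<open>G\<close> is not a multiple of \<open>F\<close> (\<open>concise_nonscalar_ApoEqu\<close>).

  \<^bold>\<open>From matrices to limits.\<close> Let \<open>A\<close> be non-scalar. If \<open>p = (x - z) q\<close> is the minimal polynomial of
  \<open>A\<close>, then \<open>N = q(A)\<close> is nonzero and \<open>N\<^sup>2\<close> is a multiple of \<open>N\<close>. If the multiple is nonzero, a scaling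
  of \<open>N\<close> is a projection \<open>P\<close> different from \<open>0\<close> and \<open>1\<close>, and \<open>F(u) = F(P u) + F(u - P u)\<close> because self-adjointness
  kills all mixed terms. If \<open>N\<^sup>2 = 0\<close>, take \<open>B\<close> with \<open>N B N = N\<close> and \<open>B N B = B\<close>, and \<open>G\<close> with
  \<open>\<nabla>G = N\<^sup>T \<nabla>F\<close>. Along the image of \<open>N B\<close> the form \<open>F\<close> is affine, and Taylor expansion gives
  \<open>F(u) = F(u - N B u) + (d/ds) G(B N u + s B u)\<close> at \<open>s = 0\<close>. Replacing the derivative by a difference
  quotient exhibits \<open>F\<close> as the limit of
  \<open>t\<^sup>-\<^sup>1 G(B N u + t B u) + (F(u - N B u) - t\<^sup>-\<^sup>1 G(B N u))\<close>,
  whose two terms use complementary sets of linear forms (\<open>nonscalar_in_closure\<close>).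

  \<^bold>\<open>From limits to matrices.\<close> The projection of a direct sum decomposition is a non-scalar element
  of \<open>sym_mats\<close>. Removing its trace and normalizing gives matrices on the unit sphere, so a sequence of
  direct sums converging to \<open>F\<close> has a subsequence along which these matrices converge; the limit has
  norm \<open>1\<close> and trace \<open>0\<close>, hence is not scalar (\<open>closure_DirSum_nonscalar\<close>).
\<close>

abbreviation lookup :: "('a \<Rightarrow>\<^sub>0 'b::zero) \<Rightarrow> 'a \<Rightarrow> 'b" where
  "lookup \<equiv> Poly_Mapping.lookup"

lemma cscale_mult_left: "cscale c F * G = cscale c (F * G)"
  by (simp add: cscale_def mult.assoc)

lemma cscale_mult_right: "F * cscale c G = cscale c (F * G)"
  by (simp add: cscale_def mult_ac)

lemma cscale_single: "cscale c (Poly_Mapping.single m a) = Poly_Mapping.single m (c * a)"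
  by (simp add: cscale_def mult_single)

lemma var_mult_single:
  "var i * Poly_Mapping.single m c = Poly_Mapping.single (Poly_Mapping.single i 1 + m) c"
  by (simp add: var_def mult_single)

lemma monom_deg_eq_0: "monom_deg m = 0 \<Longrightarrow> m = 0"
  by (auto simp: monom_deg_def intro: poly_mapping_eqI)

lemma monom_deg_SucE:
  assumes "monom_deg m = Suc k"
  obtains i m' where "m = Poly_Mapping.single i 1 + m'" "monom_deg m' = k"
proof -
  obtain i where i: "lookup m i > 0"
    using assms
    by (metis (no_types, lifting) Zero_not_Suc bot_nat_0.not_eq_extremum monom_deg_def sum.neutral)
  define m' where "m' = m - Poly_Mapping.single i 1"
  have m: "m = Poly_Mapping.single i 1 + m'"
    using i by (auto intro!: poly_mapping_eqI simp: m'_def lookup_add lookup_minus lookup_single when_def)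
  have "monom_deg m' = k"
    using assms by (simp add: m monom_deg_def lookup_add lookup_single sum.distrib when_def)
  with m show ?thesis by (rule that)
qed

text \<open>
  Derivatives and substitutions behave simply under multiplication by a single variable, so this
  induction gives product and chain rules without computing with exponents.
\<close>

lemma cpoly_var_induct [case_names const add var_mult]:
  fixes F :: "'n::finite cpoly"
  assumes const: "\<And>c. P (Poly_Mapping.single 0 c)"
    and add: "\<And>F G. P F \<Longrightarrow> P G \<Longrightarrow> P (F + G)"
    and var_mult: "\<And>i F. P F \<Longrightarrow> P (var i * F)"
  shows "P F"
proof (induction F rule: cpoly_induct)
  case zero
  then show ?case using const[of 0] by simp
next
  case (single_add m c G)
  have "P (Poly_Mapping.single m c)"
  proof (induction "monom_deg m" arbitrary: m)
    case 0
    then have "m = 0" by (intro monom_deg_eq_0) simp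
    then show ?case using const by simp
  next
    case (Suc k)
    obtain i m' where m: "m = Poly_Mapping.single i 1 + m'" and "monom_deg m' = k"
      using Suc.hyps(2) monom_deg_SucE by metis
    then show ?case
      using Suc.hyps(1)[of m'] var_mult[of "Poly_Mapping.single m' c" i] by (simp only: m var_mult_single)
  qed
  then show ?case using single_add add by blast
qed


section \<open>Partial derivatives\<close>

lemma pderiv_var_add: "pderiv_var i (F + G) = pderiv_var i F + pderiv_var i (G :: 'n::finite cpoly)"
  by (simp add: apply_diff_add_right flip: apply_diff_var)

lemma pderiv_var_0 [simp]: "pderiv_var i 0 = (0 :: 'n cpoly)"
  by (simp add: pderiv_var_def)

lemma pderiv_var_single:
  "pderiv_var i (Poly_Mapping.single m c) =
     Poly_Mapping.single (m - Poly_Mapping.single i 1) (of_nat (lookup m i) * c :: complex)"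
  by (simp add: pderiv_var_def)

lemma lookup_pderiv_var:
  fixes F :: "'n::finite cpoly"
  shows "lookup (pderiv_var i F) m
    = of_nat (lookup m i + 1) * lookup F (m + Poly_Mapping.single i 1)"
proof (induction F rule: cpoly_induct)
  case (single_add e c G)
  have "lookup (pderiv_var i (Poly_Mapping.single e c)) m
    = of_nat (lookup m i + 1) * lookup (Poly_Mapping.single e c) (m + Poly_Mapping.single i 1)"
  proof (cases "lookup e i = 0")
    case True
    then have "e \<noteq> m + Poly_Mapping.single i 1"
      by (auto simp: lookup_add)
    then show ?thesis using True by (simp add: pderiv_var_single lookup_single when_def)
  next
    case False
    then have "e - Poly_Mapping.single i 1 = m \<longleftrightarrow> e = m + Poly_Mapping.single i 1"
      by (auto simp: poly_mapping_eq_iff fun_eq_iff lookup_add lookup_minus lookup_single when_def)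
    then show ?thesis
      by (auto simp: pderiv_var_single lookup_single when_def lookup_add)
  qed
  then show ?case using single_add by (simp add: pderiv_var_add lookup_add algebra_simps)
qed simp

lemma pderiv_var_cscale: "pderiv_var i (cscale c F) = cscale c (pderiv_var i (F :: 'n::finite cpoly))"
  by (rule poly_mapping_eqI) (simp add: lookup_pderiv_var)

lemma pderiv_var_minus: "pderiv_var i (F - G) = pderiv_var i F - pderiv_var i (G :: 'n::finite cpoly)"
  by (rule poly_mapping_eqI) (simp add: lookup_pderiv_var lookup_minus algebra_simps)

lemma pderiv_var_sum: "pderiv_var i (sum f A) = (\<Sum>x\<in>A. pderiv_var i (f x :: 'n::finite cpoly))"
  by (induction A rule: infinite_finite_induct) (simp_all add: pderiv_var_add)

lemma pderiv_var_commute: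
  "pderiv_var i (pderiv_var j F) = pderiv_var j (pderiv_var i (F :: 'n::finite cpoly))"
  by (metis apply_diff_mult apply_diff_var mult.commute)

lemma pderiv_var_const [simp]: "pderiv_var i (Poly_Mapping.single 0 c) = 0"
  by (simp add: pderiv_var_single)

lemma pderiv_var_var: "pderiv_var i (var j) = (if i = j then 1 else 0)"
  by (simp add: pderiv_var_single var_def lookup_single when_def)

lemma pderiv_var_var_mult:
  fixes F :: "'n::finite cpoly"
  shows "pderiv_var i (var j * F) = (if i = j then F else 0) + var j * pderiv_var i F"
proof (induction F rule: cpoly_induct)
  case (single_add m c G)
  have "pderiv_var i (var j * Poly_Mapping.single m c)
    = (if i = j then Poly_Mapping.single m c else 0) + var j * pderiv_var i (Poly_Mapping.single m c)"
  proof (cases "i = j")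
    case True
    have "Poly_Mapping.single i 1 + (m - Poly_Mapping.single i 1) = m" if "lookup m i \<noteq> 0"
      using that by (auto simp: poly_mapping_eq_iff fun_eq_iff lookup_add lookup_minus lookup_single when_def)
    then show ?thesis
      using True by (cases "lookup m i = 0") (auto simp: var_mult_single pderiv_var_single lookup_add ring_distribs Poly_Mapping.single_add)
  next
    case False
    have "Poly_Mapping.single j 1 + m - Poly_Mapping.single i 1 = Poly_Mapping.single j 1 + (m - Poly_Mapping.single i 1)"
      using False by (auto simp: poly_mapping_eq_iff fun_eq_iff lookup_add lookup_minus lookup_single when_def)
    then show ?thesis
      using False by (simp add: var_mult_single pderiv_var_single lookup_add lookup_single)
  qed
  then show ?case using single_add by (simp add: pderiv_var_add distrib_left)
qed simp

lemma pderiv_var_mult: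
  fixes F :: "'n::finite cpoly"
  shows "pderiv_var i (F * G) = pderiv_var i F * G + F * pderiv_var i G"
proof (induction F rule: cpoly_var_induct)
  case (const c)
  then show ?case using pderiv_var_cscale[of i c G] by (simp add: cscale_def)
next
  case (add F H)
  then show ?case by (simp add: pderiv_var_add distrib_right)
next
  case (var_mult j F)
  then show ?case by (simp add: pderiv_var_var_mult mult.assoc distrib_left distrib_right)
qed

lemma pderiv_var_forms: "F \<in> forms d \<Longrightarrow> pderiv_var i F \<in> forms (d - 1)"
proof -
  assume F: "F \<in> forms d"
  have "monom_deg m = d - 1" if "lookup (pderiv_var i F) m \<noteq> 0" for m
  proof -
    have "monom_deg (m + Poly_Mapping.single i 1) = d"
      using that F by (auto simp: lookup_pderiv_var forms_def in_keys_iff)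
    then show ?thesis
      by (simp add: monom_deg_def lookup_add sum.distrib lookup_single when_def)
  qed
  then show ?thesis by (auto simp: forms_def in_keys_iff)
qed

lemma euler:
  fixes F :: "'n::finite cpoly"
  assumes "F \<in> forms d"
  shows "(\<Sum>i\<in>UNIV. var i * pderiv_var i F) = cscale (of_nat d) F"
proof (rule poly_mapping_eqI)
  fix m
  have *: "lookup (var i * pderiv_var i G) m = of_nat (lookup m i) * lookup G m" for i and G :: "'n cpoly"
  proof (induction G rule: cpoly_induct)
    case (single_add e c G)
    have "Poly_Mapping.single i 1 + (e - Poly_Mapping.single i 1) = e" if "lookup e i \<noteq> 0"
      using that by (auto simp: poly_mapping_eq_iff fun_eq_iff lookup_add lookup_minus lookup_single when_def)
    then have "lookup (var i * pderiv_var i (Poly_Mapping.single e c)) m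
        = of_nat (lookup m i) * lookup (Poly_Mapping.single e c) m"
      by (cases "lookup e i = 0") (auto simp: var_mult_single pderiv_var_single lookup_single when_def)
    then show ?case using single_add by (simp add: pderiv_var_add distrib_left lookup_add)
  qed simp
  have "of_nat d * lookup F m = of_nat (monom_deg m) * lookup F m"
    using assms by (auto simp: forms_def in_keys_iff)
  then show "lookup (\<Sum>i\<in>UNIV. var i * pderiv_var i F) m = lookup (cscale (of_nat d) F) m"
    by (simp add: lookup_sum * monom_deg_def sum_distrib_right)
qed


section \<open>Linear forms\<close>

definition lin :: "complex ^ 'n \<Rightarrow> 'n::finite cpoly" where
  "lin v = (\<Sum>j\<in>UNIV. cscale (v $ j) (var j))"

lemma lookup_lin: "lookup (lin v) m = (\<Sum>j\<in>UNIV. v $ j * lookup (var j) m)"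
  by (simp add: lin_def lookup_sum)

lemma lin_add: "lin (u + v) = lin u + lin v"
  by (rule poly_mapping_eqI) (simp add: lookup_lin lookup_add sum.distrib algebra_simps)

lemma lin_scale: "lin (c *s v) = cscale c (lin v)"
  by (rule poly_mapping_eqI) (simp add: lookup_lin sum_distrib_left mult_ac)

lemma lin_zero [simp]: "lin 0 = 0"
  by (rule poly_mapping_eqI) (simp add: lookup_lin)

lemma lin_sum: "lin (sum f A) = (\<Sum>x\<in>A. lin (f x))"
  by (induction A rule: infinite_finite_induct) (simp_all add: lin_add)

lemma lin_axis [simp]: "lin (axis i 1) = var i"
  by (rule poly_mapping_eqI) (simp add: lookup_lin axis_def if_distrib[of "\<lambda>x. x * _"] cong: if_cong)

lemma lookup_lin_single: "lookup (lin v) (Poly_Mapping.single i 1) = v $ i"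
proof -
  have "Poly_Mapping.single j (1::nat) = Poly_Mapping.single i 1 \<longleftrightarrow> j = i" for j
    by (metis lookup_single_eq lookup_single_not_eq one_neq_zero)
  then show ?thesis
    by (simp add: lookup_lin var_def lookup_single when_def if_distrib[of "\<lambda>x. _ * x"] cong: if_cong)
qed

lemma lin_eq_iff [simp]: "lin u = lin v \<longleftrightarrow> u = v"
  by (metis lookup_lin_single vec_eq_iff)

lemma lin_eq_0_iff [simp]: "lin u = 0 \<longleftrightarrow> u = 0"
  using lin_eq_iff[of u 0] by (simp del: lin_eq_iff)

lemma linear_forms_eq: "linear_forms = range lin"
proof
  have "cvs.subspace (range lin)"
  proof (rule cvs.subspaceI)
    show "0 \<in> range lin" by (rule range_eqI[of _ _ 0]) simp
  qed (auto simp flip: lin_add lin_scale)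
  moreover have "range var \<subseteq> range lin"
    by (metis image_subset_iff lin_axis rangeI)
  ultimately show "linear_forms \<subseteq> range lin"
    unfolding linear_forms_def by (rule cvs.span_minimal[rotated])
  show "range lin \<subseteq> linear_forms"
    unfolding linear_forms_def lin_def
    by (intro image_subsetI cvs.span_sum cvs.span_scale cvs.span_base rangeI)
qed

lemma pderiv_var_lin: "pderiv_var i (lin v) = Poly_Mapping.single 0 (v $ i)"
proof -
  have "pderiv_var i (lin v) = (\<Sum>j\<in>UNIV. cscale (v $ j) (if i = j then 1 else 0))"
    by (simp add: lin_def pderiv_var_sum pderiv_var_cscale pderiv_var_var)
  also have "\<dots> = (\<Sum>j\<in>UNIV. if i = j then cscale (v $ j) 1 else 0)"
    by (intro sum.cong) auto
  also have "\<dots> = Poly_Mapping.single 0 (v $ i)"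
    by (simp add: cscale_def)
  finally show ?thesis .
qed


section \<open>Substitution\<close>

text \<open>
  The image of \<open>F\<close> under the algebra homomorphism that sends the variable \<open>i\<close> to \<open>\<sigma> i\<close>.
\<close>

definition subst :: "('n \<Rightarrow> 'n cpoly) \<Rightarrow> 'n::finite cpoly \<Rightarrow> 'n cpoly" where
  "subst \<sigma> F = (\<Sum>m\<in>Poly_Mapping.keys F. cscale (lookup F m) (\<Prod>i\<in>UNIV. \<sigma> i ^ lookup m i))"

lemma subst_superset:
  assumes "finite A" "Poly_Mapping.keys F \<subseteq> A"
  shows "subst \<sigma> F = (\<Sum>m\<in>A. cscale (lookup F m) (\<Prod>i\<in>UNIV. \<sigma> i ^ lookup m i))"
  unfolding subst_def using assms
  by (intro sum.mono_neutral_left) (auto simp: in_keys_iff)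

lemma subst_add: "subst \<sigma> (F + G) = subst \<sigma> F + subst \<sigma> G"
proof -
  define A where "A = Poly_Mapping.keys F \<union> Poly_Mapping.keys G"
  have A: "finite A" "Poly_Mapping.keys F \<subseteq> A" "Poly_Mapping.keys G \<subseteq> A"
    "Poly_Mapping.keys (F + G) \<subseteq> A"
    using keys_add[of F G] by (auto simp: A_def)
  note e = subst_superset[OF A(1)]
  show ?thesis
    unfolding e[OF A(2)] e[OF A(3)] e[OF A(4)]
    by (simp add: lookup_add cvs.scale_left_distrib sum.distrib)
qed

lemma subst_0 [simp]: "subst \<sigma> 0 = 0"
  by (simp add: subst_def)

lemma subst_single:
  "subst \<sigma> (Poly_Mapping.single m c) = cscale c (\<Prod>i\<in>UNIV. \<sigma> i ^ lookup m i)"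
  by (subst subst_superset[of "{m}"]) auto

lemma subst_const [simp]: "subst \<sigma> (Poly_Mapping.single 0 c) = Poly_Mapping.single 0 c"
  by (simp add: subst_single cscale_def)

lemma subst_one [simp]: "subst \<sigma> 1 = 1"
  using subst_const[of \<sigma> 1] by simp

lemma subst_cscale: "subst \<sigma> (cscale c F) = cscale c (subst \<sigma> F)"
proof (induction F rule: cpoly_induct)
  case (single_add m a G)
  then show ?case
    by (simp add: cvs.scale_right_distrib subst_add cscale_single subst_single)
qed simp

lemma subst_sum: "subst \<sigma> (sum f A) = (\<Sum>x\<in>A. subst \<sigma> (f x))"
  by (induction A rule: infinite_finite_induct) (simp_all add: subst_add)

lemma subst_var_mult: "subst \<sigma> (var i * F) = \<sigma> i * subst \<sigma> F"
proof (induction F rule: cpoly_induct)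
  case (single_add m c G)
  have "(\<Prod>k\<in>UNIV. \<sigma> k ^ lookup (Poly_Mapping.single i 1) k) = (\<Prod>k\<in>UNIV. if k = i then \<sigma> k else 1)"
    by (intro prod.cong) (auto simp: lookup_single)
  then have "(\<Prod>k\<in>UNIV. \<sigma> k ^ lookup (Poly_Mapping.single i 1) k) = \<sigma> i" by simp
  then have "(\<Prod>k\<in>UNIV. \<sigma> k ^ lookup (Poly_Mapping.single i 1 + m) k) = \<sigma> i * (\<Prod>k\<in>UNIV. \<sigma> k ^ lookup m k)"
    by (simp add: lookup_add power_add prod.distrib)
  then have "subst \<sigma> (var i * Poly_Mapping.single m c) = \<sigma> i * subst \<sigma> (Poly_Mapping.single m c)"
    by (simp add: var_mult_single subst_single cscale_mult_right)
  then show ?case using single_add by (simp add: subst_add distrib_left)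
qed simp

lemma subst_var: "subst var F = F"
  by (induction F rule: cpoly_var_induct) (simp_all add: subst_add subst_var_mult)

lemma Sym_0: "1 \<in> Sym 0 V"
  unfolding Sym_def by (rule cvs.span_base) auto

lemma subspace_Sym: "cvs.subspace (Sym d V)"
  unfolding Sym_def by (rule cvs.subspace_span)

lemma Sym_mult:
  assumes "x \<in> V" "P \<in> Sym d V"
  shows "x * P \<in> Sym (Suc d) V"
  using assms(2) unfolding Sym_def
proof (induction P rule: cvs.span_induct_alt)
  case base
  then show ?case by (simp add: cvs.span_zero)
next
  case (step c p y)
  then obtain l where l: "\<forall>i<d. l i \<in> V" "p = (\<Prod>i<d. l i)" by auto
  have "x * p = (\<Prod>i<Suc d. (l(d := x)) i)"
    by (simp add: l(2) mult.commute)
  moreover have "\<forall>i<Suc d. (l(d := x)) i \<in> V" using l(1) assms(1) by (auto simp: less_Suc_eq)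
  ultimately have "x * p \<in> {\<Prod>i<Suc d. l i |l. \<forall>i<Suc d. l i \<in> V}"
    by blast
  then have "x * p \<in> cvs.span {\<Prod>i<Suc d. l i |l. \<forall>i<Suc d. l i \<in> V}"
    by (rule cvs.span_base)
  then show ?case using step.IH
    by (simp only: distrib_left cscale_mult_right cvs.span_add cvs.span_scale)
qed

lemma subst_in_Sym:
  fixes F :: "'n::finite cpoly"
  assumes "\<And>i. \<sigma> i \<in> V" "F \<in> forms d"
  shows "subst \<sigma> F \<in> Sym d V"
proof -
  have *: "subst \<sigma> (Poly_Mapping.single m 1) \<in> Sym (monom_deg m) V" for m
  proof (induction "monom_deg m" arbitrary: m)
    case 0
    then have "m = 0" by (intro monom_deg_eq_0) simp
    then show ?case using Sym_0[of V] 0 by (simp add: subst_single)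
  next
    case (Suc k)
    obtain i m' where m: "m = Poly_Mapping.single i 1 + m'" and k: "monom_deg m' = k"
      using Suc.hyps(2) monom_deg_SucE by metis
    have "subst \<sigma> (Poly_Mapping.single m 1) = \<sigma> i * subst \<sigma> (Poly_Mapping.single m' 1)"
      by (simp only: m flip: var_mult_single subst_var_mult)
    then show ?case using Suc.hyps(1)[of m'] k Suc.hyps(2) Sym_mult[OF assms(1)] by metis
  qed
  have "(\<Prod>i\<in>UNIV. \<sigma> i ^ lookup m i) \<in> Sym d V" if "m \<in> Poly_Mapping.keys F" for m
    using *[of m] that assms(2) by (auto simp: forms_def subst_single)
  then show ?thesis
    unfolding subst_def by (intro cvs.subspace_sum cvs.subspace_scale subspace_Sym) auto
qed

lemma Sym_mono: "V \<subseteq> W \<Longrightarrow> Sym d V \<subseteq> Sym d W"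
  unfolding Sym_def by (intro cvs.span_mono) blast

lemma Sym_forms: "V \<subseteq> linear_forms \<Longrightarrow> Sym d V \<subseteq> forms d"
  using Sym_mono Sym_linear_forms by blast


section \<open>One-parameter families of polynomials\<close>

lemma finite_lower_monoms: "finite {a::'n::finite monom. \<exists>b. m = a + b}"
proof -
  have "lookup ` {a. \<exists>b. m = a + b} \<subseteq> PiE UNIV (\<lambda>i. {..lookup m i})"
    by (auto simp: lookup_add)
  then have "finite (lookup ` {a. \<exists>b. m = a + b})"
    by (rule finite_subset) (simp add: finite_PiE)
  then show ?thesis
    by (rule finite_imageD) (auto intro: inj_onI poly_mapping_eqI)
qed

text \<open>
  The range of summation depends on the monomial only, not on the supports of the factors. This is what
  allows the sum to be differentiated when the factors depend on a parameter.
\<close>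

lemma lookup_mult_lower_monoms:
  fixes F G :: "'n::finite cpoly"
  shows "lookup (F * G) m = (\<Sum>a | \<exists>b. m = a + b. lookup F a * lookup G (m - a))"
proof (induction F rule: cpoly_induct)
  case (single_add e c F)
  have "lookup (Poly_Mapping.single e c * G) m
    = (\<Sum>a | \<exists>b. m = a + b. lookup (Poly_Mapping.single e c) a * lookup G (m - a))"
  proof (induction G rule: cpoly_induct)
    case (single_add e' c' G)
    have "(\<Sum>a | \<exists>b. m = a + b. lookup (Poly_Mapping.single e c) a * lookup (Poly_Mapping.single e' c') (m - a))
      = (\<Sum>a | \<exists>b. m = a + b. if a = e then (if m = e + e' then c * c' else 0) else 0)"
      by (intro sum.cong) (auto simp: lookup_single when_def)
    also have "\<dots> = (if m = e + e' then c * c' else 0)"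
      by (subst sum.delta[OF finite_lower_monoms]) auto
    finally show ?case using single_add
      by (simp add: mult_single lookup_add distrib_left sum.distrib lookup_single when_def)
  qed simp
  then show ?case using single_add by (simp add: distrib_right lookup_add sum.distrib)
qed simp

text \<open>
  The derivative is taken one coefficient at a time because the supports in a family of polynomials may
  vary with the parameter.
\<close>

definition coeff_deriv :: "(complex \<Rightarrow> 'n cpoly) \<Rightarrow> 'n cpoly \<Rightarrow> complex \<Rightarrow> bool" where
  "coeff_deriv f D s \<longleftrightarrow> (\<forall>m. ((\<lambda>s. lookup (f s) m) has_field_derivative lookup D m) (at s))"

lemma coeff_deriv_add:
  "coeff_deriv f D s \<Longrightarrow> coeff_deriv g E s \<Longrightarrow> coeff_deriv (\<lambda>s. f s + g s) (D + E) s"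
  by (auto simp: coeff_deriv_def lookup_add intro: DERIV_add)

lemma coeff_deriv_diff:
  "coeff_deriv f D s \<Longrightarrow> coeff_deriv g E s \<Longrightarrow> coeff_deriv (\<lambda>s. f s - g s) (D - E) s"
  by (auto simp: coeff_deriv_def lookup_minus intro: DERIV_diff)

lemma coeff_deriv_const: "coeff_deriv (\<lambda>s. C) 0 s"
  by (simp add: coeff_deriv_def)

lemma coeff_deriv_cscale: "coeff_deriv (\<lambda>s. cscale s C) C s"
  unfolding coeff_deriv_def by (auto intro!: derivative_eq_intros)

lemma coeff_deriv_mult:
  fixes f g :: "complex \<Rightarrow> 'n::finite cpoly"
  assumes "coeff_deriv f D s" "coeff_deriv g E s"
  shows "coeff_deriv (\<lambda>s. f s * g s) (D * g s + f s * E) s"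
  unfolding coeff_deriv_def
proof
  fix m
  have "((\<lambda>s. lookup (f s) a * lookup (g s) (m - a)) has_field_derivative
      lookup D a * lookup (g s) (m - a) + lookup E (m - a) * lookup (f s) a) (at s)" for a
    using assms by (intro DERIV_mult) (auto simp: coeff_deriv_def)
  then show "((\<lambda>s. lookup (f s * g s) m) has_field_derivative lookup (D * g s + f s * E) m) (at s)"
    unfolding lookup_add lookup_mult_lower_monoms sum.distrib[symmetric]
    by (intro DERIV_sum) (simp add: mult.commute)
qed

text \<open>
  The chain rule along a line of substitutions. Integrating it yields identities between forms such as
  \<open>F(u) = F(P u) + F(u - P u)\<close> for a projection \<open>P\<close>.
\<close>

lemma coeff_deriv_subst:
  fixes F :: "'n::finite cpoly"
  shows "coeff_deriv (\<lambda>s. subst (\<lambda>i. C i + cscale s (D i)) F)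
    (\<Sum>i\<in>UNIV. D i * subst (\<lambda>i. C i + cscale s (D i)) (pderiv_var i F)) s"
proof (induction F rule: cpoly_var_induct)
  case (const c)
  then show ?case by (simp add: coeff_deriv_const)
next
  case (add F G)
  from coeff_deriv_add[OF this] show ?case
    by (simp add: subst_add pderiv_var_add sum.distrib distrib_left)
next
  case (var_mult i F)
  have "coeff_deriv (\<lambda>s. C i + cscale s (D i)) (0 + D i) s"
    by (intro coeff_deriv_add coeff_deriv_const coeff_deriv_cscale)
  from coeff_deriv_mult[OF this var_mult]
  have "coeff_deriv (\<lambda>s. subst (\<lambda>i. C i + cscale s (D i)) (var i * F))
    (D i * subst (\<lambda>i. C i + cscale s (D i)) F + (C i + cscale s (D i)) *
       (\<Sum>j\<in>UNIV. D j * subst (\<lambda>i. C i + cscale s (D i)) (pderiv_var j F))) s"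
    by (simp add: subst_var_mult)
  moreover have "(\<Sum>j\<in>UNIV. D j * subst \<sigma> (pderiv_var j (var i * F)))
     = D i * subst \<sigma> F + \<sigma> i * (\<Sum>j\<in>UNIV. D j * subst \<sigma> (pderiv_var j F))" for \<sigma>
  proof -
    have "(\<Sum>j\<in>UNIV. D j * subst \<sigma> (pderiv_var j (var i * F)))
      = (\<Sum>j\<in>UNIV. (if j = i then D i * subst \<sigma> F else 0) + \<sigma> i * (D j * subst \<sigma> (pderiv_var j F)))"
      by (intro sum.cong) (auto simp: pderiv_var_var_mult subst_add subst_var_mult distrib_left mult.left_commute)
    then show ?thesis by (simp add: sum.distrib sum_distrib_left)
  qed
  ultimately show ?case by simp
qed

lemma coeff_deriv_const_eq:
  fixes K :: "'n cpoly"
  assumes "\<And>s. coeff_deriv f K s"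
  shows "f 1 = f 0 + K"
proof (rule poly_mapping_eqI)
  fix m
  have "((\<lambda>s. lookup (f s) m - s * lookup K m) has_field_derivative 0) (at s within UNIV)" for s
    using assms[of s] unfolding coeff_deriv_def by (auto intro!: derivative_eq_intros)
  then obtain c where "\<And>s. lookup (f s) m - s * lookup K m = c"
    using has_field_derivative_zero_constant[of UNIV "\<lambda>s. lookup (f s) m - s * lookup K m"] by auto
  from this[of 1] this[of 0] show "lookup (f 1) m = lookup (f 0 + K) m"
    by (simp add: lookup_add algebra_simps)
qed


section \<open>Complex matrices\<close>

lemma matrix_diff_ldistrib: "(A :: complex^'n^'n) ** (B - C) = A ** B - A ** C"
  by (simp add: matrix_matrix_mult_def vec_eq_iff right_diff_distrib sum_subtractf)

lemma matrix_diff_rdistrib: "(B - C) ** (A :: complex^'n^'n) = B ** A - C ** A"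
  by (simp add: matrix_matrix_mult_def vec_eq_iff left_diff_distrib sum_subtractf)

lemma matrix_add_rdistrib: "(B + C) ** (A :: complex^'n^'n) = B ** A + C ** A"
  by (simp add: matrix_matrix_mult_def vec_eq_iff distrib_right sum.distrib)

lemma mat_mult_component: "(mat s ** (A :: complex^'n^'n)) $ i $ j = s * A $ i $ j"
  by (simp add: matrix_matrix_mult_def mat_def if_distrib[of "\<lambda>x. x * _"] cong: if_cong)

lemma mult_mat_commute: "(A :: complex^'n^'n) ** mat s = mat s ** A"
  by (simp add: vec_eq_iff mat_mult_component)
     (simp add: matrix_matrix_mult_def mat_def if_distrib[of "\<lambda>x. _ * x"] mult.commute cong: if_cong)

lemma mult_mat_left: "(A :: complex^'n^'n) ** (mat s ** B) = mat s ** (A ** B)"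
  by (metis matrix_mul_assoc mult_mat_commute)

lemma mat_mult_mat: "mat s ** mat t = (mat (s * t) :: complex^'n^'n)"
  by (simp add: vec_eq_iff mat_mult_component) (simp add: mat_def)

lemma mat_mult_mat_left: "mat s ** (mat t ** A) = mat (s * t) ** (A :: complex^'n^'n)"
  by (simp add: matrix_mul_assoc mat_mult_mat)

lemma mat_mult_mat_mult: "(mat s ** A) ** (mat t ** B) = mat (s * t) ** ((A :: complex^'n^'n) ** (B :: complex^'n^'n))"
proof -
  have "(mat s ** A) ** (mat t ** B) = mat s ** (A ** (mat t ** B))"
    by (simp only: matrix_mul_assoc)
  then show ?thesis by (simp only: mult_mat_left[of A] mat_mult_mat_left)
qed

lemma mat_0 [simp]: "(mat 0 :: complex^'n^'n) = 0"
  by (simp add: vec_eq_iff mat_def)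

lemma matrix_mul_zero [simp]: "(0 :: complex^'n^'n) ** A = 0" "(A :: complex^'n^'n) ** 0 = 0"
  by (simp_all add: matrix_matrix_mult_def vec_eq_iff)

lemma mat_mult_eq_0_iff: "mat s ** A = (0 :: complex^'n^'n) \<longleftrightarrow> s = 0 \<or> A = 0"
  by (auto simp: vec_eq_iff mat_mult_component)

text \<open>
  A linear section of \<open>A\<close> over its image gives \<open>C\<close> with \<open>A C A = A\<close>, and then \<open>C A C\<close> satisfies both
  equations.
\<close>

lemma generalized_inverse:
  fixes A :: "complex^'n^'n"
  obtains B where "A ** B ** A = A" "B ** A ** B = B"
proof -
  obtain g where g: "Vector_Spaces.linear (*s) (*s) g" "\<And>v. A *v g (A *v v) = A *v v"
    using vec.linear_exists_right_inverse_on[of "(*v) A" UNIV] by auto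
  define C where "C = matrix g"
  have gC: "g v = C *v v" for v
    using matrix_works[OF g(1)] by (simp add: C_def)
  have ACA: "A ** C ** A = A"
    using g(2) by (subst matrix_eq) (simp add: gC flip: matrix_vector_mul_assoc)
  define B where "B = C ** A ** C"
  have "A ** B ** A = (A ** C ** A) ** C ** A"
    by (simp add: B_def matrix_mul_assoc)
  then have 1: "A ** B ** A = A" by (simp add: ACA)
  have "B ** A ** B = C ** (A ** C ** A) ** C ** A ** C"
    by (simp add: B_def matrix_mul_assoc)
  also have "\<dots> = C ** A ** C ** A ** C" by (simp only: ACA)
  also have "\<dots> = C ** (A ** C ** A) ** C" by (simp only: matrix_mul_assoc)
  also have "\<dots> = B" by (simp only: B_def ACA)
  finally have "B ** A ** B = B" .
  with 1 show ?thesis by (rule that)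
qed


section \<open>Polynomials in a matrix\<close>

definition poly_mat :: "complex poly \<Rightarrow> complex^'n^'n \<Rightarrow> complex^'n^'n" where
  "poly_mat p A = fold_coeffs (\<lambda>c B. mat c + A ** B) p 0"

lemma poly_mat_0 [simp]: "poly_mat 0 A = 0"
  by (simp add: poly_mat_def)

lemma poly_mat_pCons [simp]: "poly_mat (pCons c p) A = mat c + A ** poly_mat p A"
  by (cases "p = 0 \<and> c = 0") (auto simp: poly_mat_def)

lemma mat_add: "mat (a + b) = mat a + (mat b :: complex^'n^'n)"
  by (simp add: vec_eq_iff mat_def)

lemma poly_mat_add: "poly_mat (p + q) A = poly_mat p A + poly_mat q A"
  by (induction p q rule: poly_induct2) (simp_all add: mat_add matrix_add_ldistrib)

lemma poly_mat_smult: "poly_mat (smult c p) A = mat c ** poly_mat p A"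
  by (induction p) (simp_all add: matrix_add_ldistrib mat_mult_mat mult_mat_left)

lemma poly_mat_diff: "poly_mat (p - q) A = poly_mat p A - poly_mat q A"
  using poly_mat_add[of "p - q" q A] by (simp add: algebra_simps)

lemma poly_mat_mult: "poly_mat (p * q) A = poly_mat p A ** poly_mat q A"
  by (induction p)
     (simp_all add: poly_mat_add poly_mat_smult matrix_add_rdistrib matrix_mul_assoc)

lemma poly_mat_sum: "poly_mat (sum f S) A = (\<Sum>x\<in>S. poly_mat (f x) A)"
  by (induction S rule: infinite_finite_induct) (simp_all add: poly_mat_add)

text \<open>
  The powers of \<open>A\<close> live in a finite-dimensional space. The dependence is taken over the reals, where
  the dimension theory of Euclidean spaces applies; real coefficients are enough.
\<close>

lemma annihilating_poly:
  fixes A :: "complex^'n^'n"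
  shows "\<exists>p. p \<noteq> 0 \<and> poly_mat p A = 0"
proof -
  \<comment> \<open>If two powers coincide their set may be too small to be dependent, but then their difference is
    already annihilating.\<close>
  define f where "f k = poly_mat (monom 1 k) A" for k
  define K where "K = {..DIM(complex^'n^'n)}"
  show ?thesis
  proof (cases "inj_on f K")
    case False
    then obtain i j where ij: "i \<noteq> j" "f i = f j" by (auto simp: inj_on_def)
    then have "monom 1 i - monom 1 j \<noteq> (0 :: complex poly)"
      by (metis eq_iff_diff_eq_0 degree_monom_eq one_neq_zero)
    then show ?thesis using ij(2) poly_mat_diff[of "monom 1 i" "monom 1 j" A] unfolding f_def by (intro exI[of _ "monom 1 i - monom 1 j"] conjI) auto
  next
    case True
    then have "card (f ` K) > DIM(complex^'n^'n)"
      by (simp add: card_image K_def)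
    then have "dependent (f ` K)"
      by (intro dependent_biggerset) (simp_all add: K_def)
    then obtain u where u: "\<exists>v\<in>f ` K. u v \<noteq> 0" "(\<Sum>v\<in>f ` K. u v *\<^sub>R v) = 0"
      by (subst (asm) dependent_finite) (auto simp: K_def)
    define p where "p = (\<Sum>k\<in>K. monom (complex_of_real (u (f k))) k)"
    have "poly_mat (monom (complex_of_real c) k) A = c *\<^sub>R f k" for c k
    proof -
      have "poly_mat (smult (complex_of_real c) (monom 1 k)) A = c *\<^sub>R f k"
        unfolding poly_mat_smult f_def by (simp add: vec_eq_iff mat_mult_component) (simp add: scaleR_conv_of_real)
      then show ?thesis by (simp add: smult_monom)
    qed
    then have "poly_mat p A = (\<Sum>k\<in>K. u (f k) *\<^sub>R f k)"
      by (simp add: p_def poly_mat_sum)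
    also have "\<dots> = 0" using u(2) by (simp add: sum.reindex[OF True] o_def)
    finally have "poly_mat p A = 0" .
    moreover obtain k where "k \<in> K" "u (f k) \<noteq> 0" using u(1) by auto
    then have "coeff p k \<noteq> 0"
      by (simp add: p_def coeff_sum K_def)
    then have "p \<noteq> 0" by auto
    ultimately show ?thesis by blast
  qed
qed

text \<open>
  With \<open>p = (x - z) q\<close> annihilating and of least degree, \<open>N = q(A)\<close> is nonzero and \<open>A N = z N\<close>. Dividing
  \<open>q\<close> by \<open>x - z\<close> therefore gives \<open>N\<^sup>2 = q(z) N\<close>. A nonzero scalar \<open>N\<close> would force \<open>A = z\<close>.
\<close>

lemma quadratic_element:
  fixes A :: "complex^'n^'n"
  assumes "\<And>c. A \<noteq> mat c"
  obtains q c where "poly_mat q A \<noteq> 0" "poly_mat q A ** poly_mat q A = mat c ** poly_mat q A"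
    "\<And>b. poly_mat q A = mat b \<Longrightarrow> b = 0"
proof -
  define P where "P p \<longleftrightarrow> p \<noteq> 0 \<and> poly_mat p A = 0" for p
  obtain p where p: "P p" "\<And>q. P q \<Longrightarrow> degree p \<le> degree q"
    using annihilating_poly[of A] ex_has_least_nat[of P _ degree] by (auto simp: P_def)
  have "degree p \<noteq> 0"
  proof
    assume "degree p = 0"
    then obtain c where "p = [:c:]" by (rule degree_eq_zeroE)
    then have "c \<noteq> 0" "mat c = (0 :: complex^'n^'n)" using p(1) by (auto simp: P_def)
    then show False by (metis mat_0 mat_mult_eq_0_iff matrix_mul_rid mat_mult_component vec_eq_iff zero_neq_one mat_mult_mat mult.right_neutral)
  qed
  then obtain z where "poly p z = 0"
    using fundamental_theorem_of_algebra[of p] by (auto simp: constant_degree)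
  then obtain q where q: "p = [:-z, 1:] * q" by (auto simp: poly_eq_0_iff_dvd)
  have "q \<noteq> 0" using p(1) q by (auto simp: P_def)
  then have "degree q < degree p" unfolding q by (subst degree_mult_eq) auto
  then have N: "poly_mat q A \<noteq> 0" using p(2)[of q] \<open>q \<noteq> 0\<close> by (auto simp: P_def)
  have z: "(A - mat z) ** poly_mat q A = 0"
  proof -
    have "poly_mat [:-z, 1:] A = A - mat z"
    proof -
      have "mat (- z) = - (mat z :: complex^'n^'n)" by (simp add: vec_eq_iff mat_def)
      then show ?thesis by simp
    qed
    then show ?thesis using p(1) poly_mat_mult[of "[:-z, 1:]" q A] by (simp add: P_def q)
  qed
  obtain r where r: "q - [:poly q z:] = [:-z, 1:] * r"
    using poly_eq_0_iff_dvd[of "q - [:poly q z:]" z] by auto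
  have "q * q = (q - [:poly q z:]) * q + smult (poly q z) q"
    by (simp add: algebra_simps)
  also have "\<dots> = r * p + smult (poly q z) q"
    by (simp only: r q mult_ac)
  finally have "poly_mat (q * q) A = poly_mat (r * p + smult (poly q z) q) A"
    by (rule arg_cong)
  then have "poly_mat q A ** poly_mat q A = mat (poly q z) ** poly_mat q A"
    using p(1) by (simp add: P_def poly_mat_add poly_mat_smult poly_mat_mult)
  moreover have "b = 0" if b: "poly_mat q A = mat b" for b
    using z assms[of z] by (simp add: b mult_mat_commute mat_mult_eq_0_iff)
  ultimately show ?thesis using N that by blast
qed


section \<open>Matrices that symmetrize the Hessian\<close>

text \<open>
  The Hessian of \<open>F\<close> is split into one complex matrix for each monomial, so that conditions on it become
  equations between complex matrices.
\<close>

definition hess :: "'n::finite cpoly \<Rightarrow> 'n monom \<Rightarrow> complex^'n^'n" where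
  "hess F m = (\<chi> i j. lookup (pderiv_var i (pderiv_var j F)) m)"

text \<open>
  The self-adjoint maps of the symmetric multilinear form attached to \<open>F\<close>: a matrix belongs to this set
  when it may be moved from one argument to another.
\<close>

definition sym_mats :: "'n::finite cpoly \<Rightarrow> (complex^'n^'n) set" where
  "sym_mats F = {A. \<forall>m. transpose A ** hess F m = hess F m ** A}"

text \<open>
  Entry \<open>k\<close> of the vector field \<open>A\<^sup>T \<nabla>F\<close>.
\<close>

definition grad_mult :: "'n::finite cpoly \<Rightarrow> complex^'n^'n \<Rightarrow> 'n \<Rightarrow> 'n cpoly" where
  "grad_mult F A k = (\<Sum>i\<in>UNIV. cscale (A $ i $ k) (pderiv_var i F))"

lemma transpose_hess [simp]: "transpose (hess F m) = hess F m"
  by (simp add: transpose_def hess_def vec_eq_iff pderiv_var_commute)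

lemma lookup_pderiv_grad_mult:
  "lookup (pderiv_var i (grad_mult F A k)) m = (hess F m ** A) $ i $ k"
  by (simp add: grad_mult_def pderiv_var_sum pderiv_var_cscale lookup_sum hess_def
      matrix_matrix_mult_def mult.commute)

lemma hess_potential:
  assumes "\<And>k. pderiv_var k G = grad_mult F A k"
  shows "hess G m = hess F m ** A"
  by (simp add: vec_eq_iff hess_def assms lookup_pderiv_grad_mult)

text \<open>
  If \<open>A\<^sup>T \<nabla>F\<close> is a gradient, then \<open>H A\<close> is a Hessian, hence symmetric.
\<close>

lemma sym_mats_if_potential:
  assumes "\<And>k. pderiv_var k G = grad_mult F A k"
  shows "A \<in> sym_mats F"
  unfolding sym_mats_def
  using hess_potential[OF assms] by (auto simp: matrix_transpose_mul)
    (metis matrix_transpose_mul transpose_hess)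

lemma grad_mult_mat: "grad_mult F (mat c) k = cscale c (pderiv_var k F)"
proof -
  have "grad_mult F (mat c) k = (\<Sum>i\<in>UNIV. if i = k then cscale c (pderiv_var i F) else 0)"
    unfolding grad_mult_def by (intro sum.cong) (auto simp: mat_def)
  then show ?thesis by simp
qed

lemma grad_mult_forms: "F \<in> forms d \<Longrightarrow> grad_mult F A k \<in> forms (d - 1)"
  unfolding grad_mult_def
  by (intro cvs.subspace_sum cvs.subspace_scale subspace_forms pderiv_var_forms)

lemma cscale_const_forms: "F \<in> forms d \<Longrightarrow> cscale c F \<in> forms d"
  by (intro cvs.subspace_scale subspace_forms)

text \<open>
  The converse of \<open>sym_mats_if_potential\<close>. As for any closed homogeneous field, pairing \<open>A\<^sup>T \<nabla>F\<close> with the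
  coordinates gives a potential up to the factor \<open>d\<close>, by Euler's identity.
\<close>

lemma potential_exists:
  fixes F :: "'n::finite cpoly"
  assumes F: "F \<in> forms d" "d > 0" and A: "A \<in> sym_mats F"
  obtains G where "G \<in> forms d" "\<And>k. pderiv_var k G = grad_mult F A k"
proof -
  define G0 where "G0 = (\<Sum>k\<in>UNIV. var k * grad_mult F A k)"
  have sym: "pderiv_var i (grad_mult F A k) = pderiv_var k (grad_mult F A i)" for i k
  proof (rule poly_mapping_eqI)
    fix m
    have "transpose (hess F m ** A) = hess F m ** A"
      using A by (simp add: matrix_transpose_mul sym_mats_def)
    then have "(hess F m ** A) $ i $ k = (hess F m ** A) $ k $ i"
      by (auto simp: vec_eq_iff transpose_def)
    then show "lookup (pderiv_var i (grad_mult F A k)) m = lookup (pderiv_var k (grad_mult F A i)) m"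
      by (simp add: lookup_pderiv_grad_mult)
  qed
  have "pderiv_var i G0 = cscale (of_nat d) (grad_mult F A i)" for i
  proof -
    have "pderiv_var i G0 = (\<Sum>k\<in>UNIV. (if i = k then grad_mult F A k else 0)
        + var k * pderiv_var k (grad_mult F A i))"
      by (simp add: G0_def pderiv_var_sum pderiv_var_var_mult sym[of i])
    also have "\<dots> = grad_mult F A i + cscale (of_nat (d - 1)) (grad_mult F A i)"
      by (simp add: sum.distrib euler[OF grad_mult_forms[OF F(1)]])
    also have "\<dots> = cscale (of_nat (Suc (d - 1))) (grad_mult F A i)"
      by (rule poly_mapping_eqI) (simp add: lookup_add algebra_simps)
    finally show ?thesis using F(2) by simp
  qed
  then have 1: "pderiv_var i (cscale (1 / of_nat d) G0) = grad_mult F A i" for i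
    using F(2) by (simp only: pderiv_var_cscale cvs.scale_scale) simp
  have "var k * grad_mult F A k \<in> forms (1 + (d - 1))" for k
    using linear_forms_subset grad_mult_forms[OF F(1)]
    by (intro forms_mult) (auto simp: linear_forms_def intro: cvs.span_base)
  then have "G0 \<in> forms d"
    unfolding G0_def using F(2) by (intro cvs.subspace_sum subspace_forms) simp
  then have "cscale (1 / of_nat d) G0 \<in> forms d"
    by (rule cscale_const_forms)
  with 1 show ?thesis by (rule that[rotated])
qed

text \<open>
  If \<open>B\<close> commutes with \<open>A\<close> and both are self-adjoint, so is \<open>A B\<close>; the induction applies this to the
  polynomials in \<open>A\<close>.
\<close>

lemma sym_mats_poly_mat:
  assumes A: "A \<in> sym_mats F"
  shows "poly_mat p A \<in> sym_mats F"
proof -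
  have com: "A ** poly_mat p A = poly_mat p A ** A" for p
    using poly_mat_mult[of "[:0,1:]" p A] poly_mat_mult[of p "[:0,1:]" A]
    by (simp add: mult.commute)
  show ?thesis
    unfolding sym_mats_def
  proof (intro CollectI allI)
    fix m
    show "transpose (poly_mat p A) ** hess F m = hess F m ** poly_mat p A"
    proof (induction p)
      case (pCons c p)
      let ?H = "hess F m" and ?B = "poly_mat p A"
      have "transpose (A ** ?B) ** ?H = transpose ?B ** (transpose A ** ?H)"
        by (simp add: matrix_transpose_mul matrix_mul_assoc)
      also have "\<dots> = (transpose ?B ** ?H) ** A"
        using A by (simp add: sym_mats_def matrix_mul_assoc)
      also have "\<dots> = ?H ** (A ** ?B)"
        by (simp add: pCons.IH com matrix_mul_assoc)
      finally have "transpose (A ** ?B) ** ?H = ?H ** (A ** ?B)" .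
      moreover have "transpose (mat c + A ** ?B) = mat c + transpose (A ** ?B)"
        by (simp add: vec_eq_iff transpose_def mat_def)
      ultimately show ?case
        by (simp add: matrix_add_ldistrib matrix_add_rdistrib mult_mat_commute)
    qed (simp add: transpose_def vec_eq_iff matrix_matrix_mult_def)
  qed
qed


section \<open>Linear substitutions\<close>

text \<open>
  The form \<open>u \<mapsto> F(M u)\<close>. Composition with linear maps corresponds to matrix products acting on rows.
\<close>

definition lin_subst :: "complex^'n^'n \<Rightarrow> 'n::finite cpoly \<Rightarrow> 'n cpoly" where
  "lin_subst M F = subst (\<lambda>i. lin (M $ i)) F"

lemma lin_subst_id [simp]:
  fixes F :: "'n::finite cpoly"
  shows "lin_subst (mat 1) F = F"
proof -
  have "lin ((mat 1 :: complex^'n^'n) $ i) = var i" for i :: 'n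
  proof -
    have "(mat 1 :: complex^'n^'n) $ i = axis i 1" by (auto simp: mat_def axis_def vec_eq_iff)
    then show ?thesis by simp
  qed
  then show ?thesis by (simp add: lin_subst_def subst_var)
qed

lemma lin_mult_row: "lin ((W ** E) $ i) = (\<Sum>k\<in>UNIV. cscale (W $ i $ k) (lin (E $ k)))"
proof -
  have "(W ** E) $ i = (\<Sum>k\<in>UNIV. W $ i $ k *s E $ k)"
    by (simp add: vec_eq_iff matrix_matrix_mult_def)
  then show ?thesis by (simp add: lin_sum lin_scale)
qed

text \<open>
  The derivative of \<open>F\<close> in the direction \<open>W E u\<close> equals the pairing of \<open>W\<^sup>T \<nabla>F\<close> with \<open>E u\<close>. It moves matrices
  from the direction to the gradient, where membership in \<open>sym_mats\<close> can be used.
\<close>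

lemma directional_mult:
  "(\<Sum>i\<in>UNIV. lin ((W ** E) $ i) * lin_subst M (pderiv_var i F))
     = (\<Sum>k\<in>UNIV. lin (E $ k) * lin_subst M (grad_mult F W k))"
proof -
  have "(\<Sum>i\<in>UNIV. lin ((W ** E) $ i) * lin_subst M (pderiv_var i F))
     = (\<Sum>i\<in>UNIV. \<Sum>k\<in>UNIV. lin (E $ k) * cscale (W $ i $ k) (lin_subst M (pderiv_var i F)))"
    by (simp add: lin_mult_row sum_distrib_right cscale_mult_left cscale_mult_right)
  also have "\<dots> = (\<Sum>k\<in>UNIV. lin (E $ k) * lin_subst M (grad_mult F W k))"
    by (subst sum.swap) (simp add: lin_subst_def grad_mult_def subst_sum subst_cscale sum_distrib_left)
  finally show ?thesis .
qed

lemma coeff_deriv_lin_subst: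
  "coeff_deriv (\<lambda>s. lin_subst (C + mat s ** D) F)
     (\<Sum>i\<in>UNIV. lin (D $ i) * lin_subst (C + mat s ** D) (pderiv_var i F)) s"
proof -
  have "(mat s ** D) $ i = s *s D $ i" for s i
    by (simp add: vec_eq_iff mat_mult_component)
  then have "lin_subst (C + mat s ** D) F = subst (\<lambda>i. lin (C $ i) + cscale s (lin (D $ i))) F" for s F
    by (simp add: lin_subst_def lin_add lin_scale)
  then show ?thesis
    using coeff_deriv_subst[of "\<lambda>i. lin (C $ i)" "\<lambda>i. lin (D $ i)" F s] by simp
qed

lemma coeff_deriv_lin_subst_mult:
  "coeff_deriv (\<lambda>s. lin_subst (C + mat s ** (W ** E)) F)
     (\<Sum>k\<in>UNIV. lin (E $ k) * lin_subst (C + mat s ** (W ** E)) (grad_mult F W k)) s"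
  using coeff_deriv_lin_subst[of C "W ** E" F s] by (simp only: directional_mult)

lemma lin_subst_zero [simp]: "lin_subst M 0 = 0"
  by (simp add: lin_subst_def)

text \<open>
  \<open>F\<close> is invariant under translation by the image of \<open>W\<close> as soon as its derivatives in these directions
  vanish.
\<close>

lemma lin_subst_shift:
  assumes "\<And>k. grad_mult F W k = 0"
  shows "lin_subst (C + W ** E) F = lin_subst C F"
proof -
  have "coeff_deriv (\<lambda>s. lin_subst (C + mat s ** (W ** E)) F) 0 s" for s
    using coeff_deriv_lin_subst_mult[of C W E F s] by (simp add: assms)
  from coeff_deriv_const_eq[OF this] show ?thesis by simp
qed

text \<open>
  The Hessian of \<open>G\<close> is \<open>H A\<close>, so \<open>\<nabla>G\<close> is invariant under translation by the kernel of \<open>A\<close>: its value at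
  \<open>C u\<close> depends on \<open>A C u\<close> only.
\<close>

lemma lin_subst_potential_cong:
  assumes G: "\<And>k. pderiv_var k G = grad_mult F A k" and X: "A ** C = A ** C'"
  shows "lin_subst C (pderiv_var k G) = lin_subst C' (pderiv_var k G)"
proof -
  have "grad_mult (pderiv_var k G) (C - C') l = 0" for l
  proof (rule poly_mapping_eqI)
    fix m
    have "lookup (grad_mult (pderiv_var k G) (C - C') l) m = (hess G m ** (C - C')) $ k $ l"
      by (simp add: grad_mult_def lookup_sum hess_def matrix_matrix_mult_def
          pderiv_var_commute[of k] mult.commute)
    also have "hess G m ** (C - C') = 0"
      by (simp add: hess_potential[OF G] matrix_diff_ldistrib X flip: matrix_mul_assoc)
    finally show "lookup (grad_mult (pderiv_var k G) (C - C') l) m = lookup 0 m" by simp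
  qed
  from lin_subst_shift[OF this, of C' "mat 1"] show ?thesis by simp
qed


section \<open>Degenerate direct sums are limits of direct sums\<close>

lemma pderiv_var_lin_power:
  "pderiv_var i (lin v ^ Suc d) = cscale (of_nat (Suc d) * v $ i) (lin v ^ d)"
proof (induction d)
  case 0
  then show ?case by (simp add: pderiv_var_lin cscale_def)
next
  case (Suc d)
  have "pderiv_var i (lin v ^ Suc (Suc d)) = pderiv_var i (lin v) * lin v ^ Suc d
      + lin v * pderiv_var i (lin v ^ Suc d)"
    by (simp only: power_Suc[of _ "Suc d"] pderiv_var_mult)
  also have "\<dots> = cscale (v $ i) (lin v ^ Suc d) + cscale (of_nat (Suc d) * v $ i) (lin v ^ Suc d)"
    unfolding Suc.IH by (simp add: cscale_mult_right pderiv_var_lin cscale_def)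
  also have "\<dots> = cscale (of_nat (Suc (Suc d)) * v $ i) (lin v ^ Suc d)"
    by (rule poly_mapping_eqI) (simp add: lookup_add ring_distribs)
  finally show ?case .
qed

lemma lin_power_eq_0_iff: "lin v ^ d = 0 \<longleftrightarrow> v = 0 \<and> d > 0"
proof (cases "v = 0")
  case False
  then obtain i where i: "v $ i \<noteq> 0" by (auto simp: vec_eq_iff)
  have "lin v ^ d \<noteq> 0"
  proof (induction d)
    case (Suc d)
    show ?case
    proof
      assume "lin v ^ Suc d = 0"
      then have "cscale (of_nat (Suc d) * v $ i) (lin v ^ d) = 0"
        by (metis pderiv_var_lin_power pderiv_var_0)
      then show False using Suc i of_nat_neq_0[of d, where ?'a = complex] by simp
    qed
  qed simp
  then show ?thesis using False by simp
qed (auto simp: power_0_left)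

lemma lin_power_in_Sym: "x \<in> V \<Longrightarrow> x ^ d \<in> Sym d V"
proof (induction d)
  case 0
  then show ?case using Sym_0 by simp
next
  case (Suc d)
  then show ?case using Sym_mult[of x V "x ^ d" d] by simp
qed

lemma approx_nonzero_Sym:
  fixes V :: "'n::finite cpoly set"
  assumes "V \<subseteq> linear_forms" "V \<noteq> {0}" "cvs.subspace V" "F \<in> Sym d V" "e > 0"
  obtains F' where "F' \<in> Sym d V" "F' \<noteq> 0" "dist F' F < e"
proof (cases "F = 0")
  case False
  then show ?thesis using that[of F] assms by simp
next
  case True
  obtain x where x: "x \<in> V" "x \<noteq> 0" using assms(2,3) cvs.subspace_0 by blast
  then obtain v where v: "x = lin v" using assms(1) linear_forms_eq by blast
  define P where "P = x ^ d"
  have P: "P \<noteq> 0" using x(2) by (simp add: P_def v lin_power_eq_0_iff)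
  define r where "r = e / (2 * norm P)"
  have r: "r > 0" using P assms(5) by (simp add: r_def)
  have "cscale (of_real r) P = r *\<^sub>R P"
    by (rule poly_mapping_eqI) (simp add: scaleR_poly_mapping_def scaleR_conv_of_real)
  then have "norm (cscale (of_real r) P) = e / 2"
    using P assms(5) by (simp add: r_def)
  then have "dist (cscale (of_real r) P) F < e" using True assms(5) by simp
  moreover have "cscale (of_real r) P \<in> Sym d V"
    unfolding P_def using x(1) by (intro cvs.subspace_scale subspace_Sym lin_power_in_Sym)
  ultimately show ?thesis using that P r by simp
qed

lemma direct_decomp_subset:
  assumes "direct_decomp V1 V2"
  shows "V1 \<subseteq> linear_forms" "V2 \<subseteq> linear_forms"
proof -
  have 0: "0 \<in> V1" "0 \<in> V2" and s: "{a + b |a b. a \<in> V1 \<and> b \<in> V2} = linear_forms"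
    using assms by (auto simp: direct_decomp_def cvs.subspace_0)
  show "V1 \<subseteq> linear_forms"
  proof
    fix x assume "x \<in> V1"
    then have "x + 0 \<in> {a + b |a b. a \<in> V1 \<and> b \<in> V2}" using 0 by blast
    then show "x \<in> linear_forms" using s by simp
  qed
  show "V2 \<subseteq> linear_forms"
  proof
    fix x assume "x \<in> V2"
    then have "0 + x \<in> {a + b |a b. a \<in> V1 \<and> b \<in> V2}" using 0 by blast
    then show "x \<in> linear_forms" using s by simp
  qed
qed

text \<open>
  A summand may vanish here: it is then approximated by a small multiple of the \<open>d\<close>-th power of a nonzero
  linear form. Thus the constructions below need not check that both summands are nonzero.
\<close>

lemma weak_direct_sum_in_closure:
  assumes V: "direct_decomp V1 V2" "V1 \<noteq> {0}" "V2 \<noteq> {0}"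
    and F: "F1 \<in> Sym d V1" "F2 \<in> Sym d V2"
  shows "F1 + F2 \<in> closure (DirSum d)"
  unfolding closure_approachable
proof (intro allI impI)
  fix e :: real assume e: "e > 0"
  note sub = direct_decomp_subset[OF V(1)]
  obtain F1' where F1': "F1' \<in> Sym d V1" "F1' \<noteq> 0" "dist F1' F1 < e / 2"
    using approx_nonzero_Sym[OF sub(1) V(2) _ F(1), of "e / 2"] V(1) e by (auto simp: direct_decomp_def)
  obtain F2' where F2': "F2' \<in> Sym d V2" "F2' \<noteq> 0" "dist F2' F2 < e / 2"
    using approx_nonzero_Sym[OF sub(2) V(3) _ F(2), of "e / 2"] V(1) e by (auto simp: direct_decomp_def)
  have "F1' + F2' \<in> forms d"
    using F1'(1) F2'(1) Sym_forms[OF sub(1)] Sym_forms[OF sub(2)]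
    by (intro cvs.subspace_add subspace_forms) blast+
  then have "F1' + F2' \<in> DirSum d"
    unfolding DirSum_def using V(1) F1' F2' by blast
  moreover have "dist (F1' + F2') (F1 + F2) < e"
    using dist_triangle_add[of F1' F2' F1 F2] F1'(3) F2'(3) by linarith
  ultimately show "\<exists>y\<in>DirSum d. dist y (F1 + F2) < e" by blast
qed


section \<open>Direct decompositions from matrices\<close>

text \<open>
  The linear forms that factor through \<open>M\<close>.
\<close>

definition row_space :: "complex^'n^'n \<Rightarrow> 'n::finite cpoly set" where
  "row_space M = range (\<lambda>a. lin (a v* M))"

lemma row_in_row_space: "lin ((Y ** M) $ i) \<in> row_space M"
proof -
  have "(Y ** M) $ i = Y $ i v* M"
    by (simp add: vec_eq_iff matrix_matrix_mult_def vector_matrix_mult_def mult.commute)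
  then show ?thesis by (auto simp: row_space_def)
qed

lemma subspace_row_space: "cvs.subspace (row_space M)"
proof (rule cvs.subspaceI)
  show "0 \<in> row_space M"
    unfolding row_space_def by (rule range_eqI[of _ _ 0]) simp
next
  fix x y assume "x \<in> row_space M" "y \<in> row_space M"
  then obtain a b where "x = lin (a v* M)" "y = lin (b v* M)" by (auto simp: row_space_def)
  then have "x + y = lin ((a + b) v* M)" by (simp add: vector_matrix_left_distrib lin_add)
  then show "x + y \<in> row_space M" by (simp add: row_space_def)
next
  fix c x assume "x \<in> row_space M"
  then obtain a where "x = lin (a v* M)" by (auto simp: row_space_def)
  then have "cscale c x = lin ((c *s a) v* M)"
    by (simp add: vector_matrix_mult_def lin_scale[symmetric] vector_scalar_mult_def sum_distrib_left mult_ac)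
  then show "cscale c x \<in> row_space M" by (simp add: row_space_def)
qed

lemma lin_subst_mult_in_Sym: "F \<in> forms d \<Longrightarrow> lin_subst (Y ** M) F \<in> Sym d (row_space M)"
  unfolding lin_subst_def by (intro subst_in_Sym row_in_row_space)

lemma lin_subst_in_Sym: "F \<in> forms d \<Longrightarrow> lin_subst M F \<in> Sym d (row_space M)"
  using lin_subst_mult_in_Sym[of F d "mat 1" M] by simp

lemma row_space_nonzero: "M \<noteq> 0 \<Longrightarrow> row_space M \<noteq> {0}"
proof
  assume "M \<noteq> 0" and *: "row_space M = {0}"
  then obtain i where i: "M $ i \<noteq> 0" by (auto simp: vec_eq_iff)
  have "lin (M $ i) \<in> row_space M" using row_in_row_space[of "mat 1" M i] by simp
  then show False using i * by simp
qed

text \<open>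
  The first equation says that the two row spaces span; right multiplication by \<open>Z\<close> is the identity on the
  first and zero on the second, so they meet in \<open>0\<close>.
\<close>

lemma direct_decomp_row_space:
  assumes "X ** M1 + Y ** M2 = mat 1" "M1 ** Z = M1" "M2 ** Z = 0"
  shows "direct_decomp (row_space M1) (row_space M2)"
  unfolding direct_decomp_def
proof (intro conjI subspace_row_space)
  have "lin a \<in> {a + b |a b. a \<in> row_space M1 \<and> b \<in> row_space M2}" for a
  proof -
    have "a = a v* (X ** M1 + Y ** M2)" by (simp add: assms(1))
    also have "\<dots> = (a v* X) v* M1 + (a v* Y) v* M2"
      by (simp add: vector_matrix_mult_add_rdistrib vector_matrix_mul_assoc)
    finally have "lin a = lin ((a v* X) v* M1) + lin ((a v* Y) v* M2)"
      by (metis lin_add)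
    then show ?thesis by (auto simp: row_space_def)
  qed
  moreover have "{a + b |a b. a \<in> row_space M1 \<and> b \<in> row_space M2} \<subseteq> range lin"
    by (auto simp: row_space_def simp flip: lin_add)
  ultimately show "{a + b |a b. a \<in> row_space M1 \<and> b \<in> row_space M2} = linear_forms"
    unfolding linear_forms_eq by blast
  have "x = 0" if "x \<in> row_space M1" "x \<in> row_space M2" for x
  proof -
    from that obtain a b where ab: "x = lin (a v* M1)" "a v* M1 = b v* M2"
      by (auto simp: row_space_def)
    have "a v* M1 = (a v* M1) v* Z" by (simp add: vector_matrix_mul_assoc assms(2))
    also have "\<dots> = 0" by (simp add: ab(2) vector_matrix_mul_assoc assms(3))
    finally show ?thesis by (simp add: ab(1))
  qed
  then show "row_space M1 \<inter> row_space M2 = {0}"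
    using cvs.subspace_0[OF subspace_row_space] by blast
qed


section \<open>From non-scalar matrices to limits of direct sums\<close>

lemma Sym_singleton_0: "d > 0 \<Longrightarrow> F \<in> Sym d {0} \<Longrightarrow> F = (0 :: 'n cpoly)"
proof -
  assume d: "d > 0" and F: "F \<in> Sym d {0}"
  have "{\<Prod>i<d. l i |l. \<forall>i<d. l i \<in> {0}} \<subseteq> {0 :: 'n cpoly}"
    using d by (auto simp: power_0_left)
  then have "Sym d {0} \<subseteq> ({0} :: 'n cpoly set)"
    unfolding Sym_def by (intro cvs.span_minimal cvs.subspace_single_0)
  then show ?thesis using F by blast
qed

lemma lin_subst_0_form: "F \<in> forms d \<Longrightarrow> d > 0 \<Longrightarrow> lin_subst 0 F = 0"
proof -
  assume F: "F \<in> forms d" "d > 0"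
  have "lin_subst 0 F \<in> Sym d {0}" unfolding lin_subst_def using F by (intro subst_in_Sym) simp_all
  then show ?thesis using Sym_singleton_0[OF F(2)] by blast
qed

text \<open>
  Compare \<open>F(u - P u + s P u)\<close> with \<open>F(s P u)\<close>. Their derivatives in \<open>s\<close> pair \<open>\<nabla>G = P\<^sup>T \<nabla>F\<close>, taken at two
  points with the same image under \<open>P\<close>, with the same vector \<open>P u\<close>; so they agree, and the difference of the two
  families is the same at \<open>s = 1\<close> and at \<open>s = 0\<close>.
\<close>

lemma idempotent_splits:
  fixes F :: "'n::finite cpoly"
  assumes F: "F \<in> forms d" "d > 0" and P: "P \<in> sym_mats F" "P ** P = P"
  shows "F = lin_subst P F + lin_subst (mat 1 - P) F"
proof -
  obtain G where G: "G \<in> forms d" "\<And>k. pderiv_var k G = grad_mult F P k"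
    using potential_exists[OF F P(1)] by blast
  let ?f = "\<lambda>s. lin_subst (mat 1 - P + mat s ** (P ** P)) F - lin_subst (0 + mat s ** (P ** P)) F"
  have "coeff_deriv ?f 0 s" for s
  proof -
    have "lin_subst (mat 1 - P + mat s ** (P ** P)) (grad_mult F P k)
        = lin_subst (0 + mat s ** (P ** P)) (grad_mult F P k)" for k
      using lin_subst_potential_cong[OF G(2), of "mat 1 - P + mat s ** (P ** P)" "0 + mat s ** (P ** P)" k]
      by (simp add: G(2) matrix_add_ldistrib matrix_diff_ldistrib P(2))
    then show ?thesis
      using coeff_deriv_diff[OF coeff_deriv_lin_subst_mult[of "mat 1 - P" P P F s] coeff_deriv_lin_subst_mult[of 0 P P F s]]
      by simp
  qed
  from coeff_deriv_const_eq[OF this] show ?thesis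
    by (simp add: P(2) lin_subst_0_form[OF F] algebra_simps)
qed

lemma idempotent_in_closure:
  fixes F :: "'n::finite cpoly"
  assumes F: "F \<in> forms d" "d > 0" and P: "P \<in> sym_mats F" "P ** P = P" "P \<noteq> 0" "P \<noteq> mat 1"
  shows "F \<in> closure (DirSum d)"
proof -
  have "direct_decomp (row_space P) (row_space (mat 1 - P))"
    by (rule direct_decomp_row_space[of "mat 1" _ "mat 1" _ P])
       (simp_all add: P(2) matrix_diff_rdistrib)
  moreover have "mat 1 - P \<noteq> 0" using P(4) by simp
  ultimately have "lin_subst P F + lin_subst (mat 1 - P) F \<in> closure (DirSum d)"
    using weak_direct_sum_in_closure[OF _ row_space_nonzero[OF P(3)] row_space_nonzero
        lin_subst_in_Sym[OF F(1), of P] lin_subst_in_Sym[OF F(1), of "mat 1 - P"]] by simp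
  then show ?thesis using idempotent_splits[OF F P(1,2)] by simp
qed

lemma finite_monom_deg: "finite {m :: 'n::finite monom. monom_deg m = d}"
proof -
  have "lookup m i \<le> monom_deg m" for m :: "'n monom" and i
    unfolding monom_deg_def by (rule member_le_sum) auto
  then have "lookup ` {m :: 'n monom. monom_deg m = d} \<subseteq> PiE UNIV (\<lambda>i. {..d})"
    by (intro image_subsetI PiE_I) (metis (mono_tags) atMost_iff mem_Collect_eq, simp)
  then have "finite (lookup ` {m :: 'n monom. monom_deg m = d})"
    by (rule finite_subset) (simp add: finite_PiE)
  then show ?thesis
    by (rule finite_imageD) (simp add: inj_on_def lookup_inject)
qed

text \<open>
  There are finitely many monomials of degree \<open>d\<close>, so for forms coefficientwise convergence is norm
  convergence.
\<close>

lemma tendsto_forms: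
  fixes F :: "'n::finite cpoly"
  assumes "eventually (\<lambda>x. f x \<in> forms d) net" "F \<in> forms d"
    and "\<And>m. ((\<lambda>x. lookup (f x) m) \<longlongrightarrow> lookup F m) net"
  shows "(f \<longlongrightarrow> F) net"
proof (rule iffD2[OF tendsto_dist_iff], rule tendsto_sandwich[OF _ _ tendsto_const])
  let ?g = "\<lambda>x. \<Sum>m | monom_deg m = d. dist (lookup (f x) m) (lookup F m)"
  show "eventually (\<lambda>x. 0 \<le> dist (f x) F) net" by simp
  show "eventually (\<lambda>x. dist (f x) F \<le> ?g x) net"
    using assms(1)
  proof eventually_elim
    case (elim x)
    then show ?case
      unfolding dist_poly_mapping_def using assms(2)
      by (intro sum_mono2 finite_monom_deg) (auto simp: forms_def)
  qed
  have "(?g \<longlongrightarrow> (\<Sum>m | monom_deg m = d. dist (lookup F m) (lookup F m))) net"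
    by (intro tendsto_intros assms)
  then show "(?g \<longlongrightarrow> 0) net" by simp
qed

text \<open>
  Along \<open>s \<mapsto> F(u - A B u + s A B u)\<close> the derivative pairs \<open>\<nabla>G\<close> with \<open>B u\<close> at a point whose image under \<open>A\<close>
  is \<open>A u\<close>, whatever \<open>s\<close> is, because \<open>A\<^sup>2 = 0\<close>. So the family is affine in \<open>s\<close>, and \<open>\<nabla>G\<close> may be evaluated at
  \<open>B A u\<close>, which has the same image under \<open>A\<close>.
\<close>

lemma square_zero_taylor:
  fixes F :: "'n::finite cpoly"
  assumes G: "\<And>k. pderiv_var k G = grad_mult F A k"
    and A: "A ** A = 0" and B: "A ** B ** A = A"
  shows "F = lin_subst (mat 1 - A ** B) F + (\<Sum>k\<in>UNIV. lin (B $ k) * lin_subst (B ** A) (pderiv_var k G))"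
proof -
  have "A ** (mat 1 - A ** B + mat s ** (A ** B)) = A ** (B ** A)" for s
  proof -
    have "A ** (A ** B) = 0" "A ** (B ** A) = A"
      using A B by (simp_all add: matrix_mul_assoc)
    then show ?thesis by (simp add: matrix_add_ldistrib matrix_diff_ldistrib mult_mat_left[of A])
  qed
  from lin_subst_potential_cong[OF G this]
  have "coeff_deriv (\<lambda>s. lin_subst (mat 1 - A ** B + mat s ** (A ** B)) F)
     (\<Sum>k\<in>UNIV. lin (B $ k) * lin_subst (B ** A) (pderiv_var k G)) s" for s
    using coeff_deriv_lin_subst_mult[of "mat 1 - A ** B" A B F s] by (simp add: G)
  from coeff_deriv_const_eq[OF this] show ?thesis by simp
qed

text \<open>
  The derivative term of \<open>square_zero_taylor\<close> is the derivative at \<open>0\<close> of \<open>t \<mapsto> G((B A + t B) u)\<close>. Its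
  difference quotients, added to \<open>F((1 - A B) u)\<close>, are direct sums in the weak sense: the rows of
  \<open>B A + t B\<close> and of \<open>1 - A B\<close> span complementary spaces when \<open>t \<noteq> 0\<close>, and \<open>G(B A u)\<close> uses the second
  space only, since \<open>A = A (1 - A B)\<close>.
\<close>

lemma square_zero_in_closure:
  fixes F :: "'n::finite cpoly"
  assumes F: "F \<in> forms d" "d > 0" and A: "A \<in> sym_mats F" "A ** A = 0" "A \<noteq> 0"
  shows "F \<in> closure (DirSum d)"
proof -
  obtain B where B: "A ** B ** A = A" "B ** A ** B = B" by (rule generalized_inverse)
  obtain G where G: "G \<in> forms d" "\<And>k. pderiv_var k G = grad_mult F A k"
    using potential_exists[OF F A(1)] by blast
  define K where "K = (\<Sum>k\<in>UNIV. lin (B $ k) * lin_subst (B ** A) (pderiv_var k G))"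
  define q where "q = mat 1 - A ** B"
  define M where "M t = B ** A + mat t ** B" for t
  define f where "f t = cscale (inverse t) (lin_subst (M t) G) + (lin_subst q F - cscale (inverse t) (lin_subst (B ** A) G))" for t
  have Fdec: "F = lin_subst q F + K"
    using square_zero_taylor[OF G(2) A(2) B(1)] by (simp add: K_def q_def)
  have B': "A ** (B ** A) = A" using B(1) by (simp add: matrix_mul_assoc)
  have Aq: "A ** q = A"
    by (simp add: q_def matrix_diff_ldistrib matrix_mul_assoc A(2))
  have "f t \<in> closure (DirSum d)" if t: "t \<noteq> 0" for t
    unfolding f_def
  proof (rule weak_direct_sum_in_closure)
    \<comment> \<open>\<open>Z\<close> is found by solving \<open>(B A + t B) Z = B A + t B\<close> and \<open>q Z = 0\<close> with the relations of \<open>A\<close> and \<open>B\<close>.\<close>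
    define Z where "Z = mat (inverse t) ** A + A ** B"
    show "direct_decomp (row_space (M t)) (row_space q)"
    proof (rule direct_decomp_row_space)
      have e: "A ** M t = A + mat t ** (A ** B)"
        by (simp add: M_def matrix_add_ldistrib mult_mat_left[of A] B')
      have "(mat (inverse t) ** A) ** M t = mat (inverse t) ** A + A ** B"
        using t by (simp only: e matrix_mul_assoc[symmetric] matrix_add_ldistrib mat_mult_mat_left) simp
      moreover have "(mat 1 - mat (inverse t) ** A) ** q = mat 1 - A ** B - mat (inverse t) ** A"
        by (simp add: matrix_diff_rdistrib Aq flip: matrix_mul_assoc) (simp add: q_def)
      ultimately show "(mat (inverse t) ** A) ** M t + (mat 1 - mat (inverse t) ** A) ** q = mat 1"
        by simp
      have BAA: "(B ** A) ** A = 0" by (simp add: A(2) flip: matrix_mul_assoc)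
      have "(B ** A) ** (mat (inverse t) ** A) = 0"
        by (simp add: mult_mat_left[of "B ** A"] BAA)
      moreover have "(B ** A) ** (A ** B) = 0"
        by (simp only: matrix_mul_assoc BAA matrix_mul_zero)
      moreover have "(mat t ** B) ** (mat (inverse t) ** A) = B ** A"
        using t by (simp add: mat_mult_mat_mult)
      moreover have "(mat t ** B) ** (A ** B) = mat t ** B"
        by (metis B(2) matrix_mul_assoc)
      ultimately show "M t ** Z = M t"
        by (simp add: M_def Z_def matrix_add_ldistrib matrix_add_rdistrib)
      have "(A ** B) ** (mat (inverse t) ** A) = mat (inverse t) ** A"
        by (simp only: mult_mat_left[of "A ** B"] B(1))
      moreover have "(A ** B) ** (A ** B) = A ** B"
        by (simp only: matrix_mul_assoc B(1))
      ultimately show "q ** Z = 0"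
        by (simp add: q_def Z_def matrix_diff_rdistrib matrix_add_ldistrib)
    qed
    have "M t ** A \<noteq> 0"
    proof
      assume "M t ** A = 0"
      then have "A ** (M t ** A) = 0" by simp
      moreover have "A ** (M t ** A) = mat t ** A"
      proof -
        have "(B ** A) ** A = 0" by (simp add: A(2) flip: matrix_mul_assoc)
        then have "M t ** A = mat t ** (B ** A)"
          by (simp only: M_def matrix_add_rdistrib matrix_mul_assoc) simp
        then show ?thesis by (simp only: mult_mat_left[of A] B')
      qed
      ultimately show False using t A(3) by (simp add: mat_mult_eq_0_iff)
    qed
    then show "row_space (M t) \<noteq> {0}" by (intro row_space_nonzero) auto
    show "row_space q \<noteq> {0}"
      using Aq A(3) by (intro row_space_nonzero) auto
    show "cscale (inverse t) (lin_subst (M t) G) \<in> Sym d (row_space (M t))"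
      by (intro cvs.subspace_scale subspace_Sym lin_subst_in_Sym G)
    have "lin_subst (B ** A) G \<in> Sym d (row_space q)"
      using lin_subst_mult_in_Sym[OF G(1), of "B ** A" q] by (simp add: Aq flip: matrix_mul_assoc)
    then show "lin_subst q F - cscale (inverse t) (lin_subst (B ** A) G) \<in> Sym d (row_space q)"
      by (intro cvs.subspace_diff cvs.subspace_scale subspace_Sym lin_subst_in_Sym F)
  qed
  then have ev: "eventually (\<lambda>t. f t \<in> closure (DirSum d)) (at 0)"
    by (auto simp: eventually_at_filter)
  have cl: "closure (DirSum d) \<subseteq> (forms d :: 'n cpoly set)"
    by (intro closure_minimal closed_forms) (auto simp: DirSum_def)
  have "(f \<longlongrightarrow> F) (at 0)"
  proof (rule tendsto_forms)
    show "eventually (\<lambda>t. f t \<in> forms d) (at 0)"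
      using ev cl by (auto elim!: eventually_mono)
    fix m
    have "((\<lambda>t. lookup (lin_subst (M t) G) m) has_field_derivative lookup K m) (at 0)"
      using coeff_deriv_lin_subst[of "B ** A" B G 0] by (simp add: coeff_deriv_def M_def K_def)
    then have "((\<lambda>t. (lookup (lin_subst (M t) G) m - lookup (lin_subst (M 0) G) m) / (t - 0)) \<longlongrightarrow> lookup K m) (at 0)"
      by (simp add: has_field_derivative_iff)
    then have "((\<lambda>t. lookup (lin_subst q F) m + (lookup (lin_subst (M t) G) m - lookup (lin_subst (M 0) G) m) / (t - 0))
        \<longlongrightarrow> lookup (lin_subst q F) m + lookup K m) (at 0)"
      by (intro tendsto_intros)
    moreover have "lookup (lin_subst q F) m + lookup K m = lookup F m"
      by (subst Fdec) (simp add: lookup_add)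
    moreover have "lookup (lin_subst q F) m + (lookup (lin_subst (M t) G) m - lookup (lin_subst (M 0) G) m) / (t - 0)
       = lookup (f t) m" for t
      by (simp add: f_def lookup_add lookup_minus M_def divide_inverse algebra_simps)
    ultimately show "((\<lambda>t. lookup (f t) m) \<longlongrightarrow> lookup F m) (at 0)" by simp
  qed fact
  from Lim_in_closed_set[OF closed_closure ev _ this] show ?thesis by simp
qed

lemma sym_mats_scale: "A \<in> sym_mats F \<Longrightarrow> mat c ** A \<in> sym_mats F"
proof -
  assume A: "A \<in> sym_mats F"
  have "transpose (mat c ** A) = mat c ** transpose A"
    by (simp add: vec_eq_iff transpose_def mat_mult_component)
  then show ?thesis
    using A unfolding sym_mats_def by (auto simp: mult_mat_left[of "hess F _"] simp flip: matrix_mul_assoc)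
qed

text \<open>
  The element \<open>N\<close> of \<open>quadratic_element\<close> stays in \<open>sym_mats F\<close>. It is square-zero or, after scaling, a
  projection other than \<open>0\<close> and \<open>1\<close>.
\<close>

theorem nonscalar_in_closure:
  fixes F :: "'n::finite cpoly"
  assumes F: "F \<in> forms d" "d > 0" and A: "A \<in> sym_mats F" "\<And>c. A \<noteq> mat c"
  shows "F \<in> closure (DirSum d)"
proof -
  obtain q c where N: "poly_mat q A \<noteq> 0"
    "poly_mat q A ** poly_mat q A = mat c ** poly_mat q A"
    "\<And>b. poly_mat q A = mat b \<Longrightarrow> b = 0"
    using quadratic_element[OF A(2)] by blast
  let ?N = "poly_mat q A"
  have S: "?N \<in> sym_mats F" by (rule sym_mats_poly_mat[OF A(1)])
  show ?thesis
  proof (cases "c = 0")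
    case True
    then show ?thesis using square_zero_in_closure[OF F S] N by simp
  next
    case False
    have ne: "mat (1 / c) ** ?N \<noteq> mat 1"
    proof
      assume "mat (1 / c) ** ?N = mat 1"
      then have "mat c ** (mat (1 / c) ** ?N) = mat c ** mat 1" by simp
      then have "?N = mat c" using False by (simp add: mat_mult_mat_left)
      then show False using N(3) False by blast
    qed
    moreover have "(mat (1 / c) ** ?N) ** (mat (1 / c) ** ?N) = mat (1 / c) ** ?N"
      using False by (simp add: mat_mult_mat_mult N(2) mat_mult_mat_left)
    ultimately show ?thesis
      using ne idempotent_in_closure[OF F sym_mats_scale[OF S, of "1 / c"]] N(1) False
      by (simp add: mat_mult_eq_0_iff)
  qed
qed


section \<open>The apolar pairing\<close>

lemma diff_coeff_nonzero_le:
  assumes "diff_coeff m e \<noteq> 0"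
  shows "lookup m i \<le> lookup e i"
proof (rule ccontr)
  assume "\<not> lookup m i \<le> lookup e i"
  then have "(\<Prod>j<lookup m i. of_nat (lookup e i) - of_nat j :: complex) = 0"
    by (intro prod_zero bexI[of _ "lookup e i"]) auto
  then have "diff_coeff m e = 0"
    unfolding diff_coeff_def by (intro prod_zero bexI[of _ i]) auto
  with assms show False by simp
qed

lemma diff_coeff_self: "diff_coeff m m \<noteq> 0"
  by (auto simp: diff_coeff_def)

text \<open>
  On forms of the same degree \<open>\<Theta> \<circ> F\<close> is a constant, and this is its value. The monomials are orthogonal
  with nonzero squares, so the pairing is symmetric and perfect.
\<close>

definition pairing :: "'n::finite cpoly \<Rightarrow> 'n cpoly \<Rightarrow> complex" where
  "pairing \<Theta> F = lookup (apply_diff \<Theta> F) 0"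

lemma apply_diff_forms:
  assumes "\<Theta> \<in> forms p" "F \<in> forms q"
  shows "apply_diff \<Theta> F \<in> forms (q - p)"
  unfolding apply_diff_def
proof (intro cvs.subspace_sum subspace_forms)
  fix m e assume me: "m \<in> Poly_Mapping.keys \<Theta>" "e \<in> Poly_Mapping.keys F"
  show "Poly_Mapping.single (e - m) (lookup \<Theta> m * lookup F e * diff_coeff m e) \<in> forms (q - p)"
  proof (cases "diff_coeff m e = 0")
    case False
    then have "monom_deg (e - m) = monom_deg e - monom_deg m"
      unfolding monom_deg_def lookup_minus
      by (intro sum_subtractf_nat diff_coeff_nonzero_le)
    then show ?thesis using assms me by (auto simp: forms_def)
  qed (simp add: forms_def)
qed

lemma pairing_add_right: "pairing \<Theta> (F + G) = pairing \<Theta> F + pairing \<Theta> G"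
  by (simp add: pairing_def apply_diff_add_right lookup_add)

lemma pairing_add_left: "pairing (\<Theta> + \<Psi>) F = pairing \<Theta> F + pairing \<Psi> F"
  by (simp add: pairing_def apply_diff_add_left lookup_add)

lemma pairing_0 [simp]: "pairing 0 F = 0" "pairing \<Theta> 0 = 0"
  by (simp_all add: pairing_def)

lemma pairing_single:
  "pairing (Poly_Mapping.single m c) F = c * diff_coeff m m * lookup F m"
proof (induction F rule: cpoly_induct)
  case (single_add e b G)
  have "pairing (Poly_Mapping.single m c) (Poly_Mapping.single e b)
      = c * diff_coeff m m * lookup (Poly_Mapping.single e b) m"
  proof (cases "e = m")
    case True
    then show ?thesis by (simp add: pairing_def apply_diff_single)
  next
    case False
    have "diff_coeff m e = 0" if "e - m = 0"
    proof (rule ccontr)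
      assume "diff_coeff m e \<noteq> 0"
      then have "lookup m i = lookup e i" for i
        using diff_coeff_nonzero_le[of m e i] arg_cong[OF that, of "\<lambda>f. lookup f i"]
        by (simp add: lookup_minus)
      then show False using False by (metis poly_mapping_eqI)
    qed
    then show ?thesis using False
      by (auto simp: pairing_def apply_diff_single lookup_single when_def)
  qed
  then show ?case using single_add by (simp add: pairing_add_right lookup_add algebra_simps)
qed simp

lemma pairing_commute: "pairing \<Theta> F = pairing F \<Theta>"
proof (induction F rule: cpoly_induct)
  case (single_add m c G)
  have "pairing \<Theta> (Poly_Mapping.single m c) = pairing (Poly_Mapping.single m c) \<Theta>"
  proof (induction \<Theta> rule: cpoly_induct)
    case (single_add m' c' \<Theta>)
    then show ?case
      by (simp add: pairing_add_left pairing_add_right pairing_single lookup_single when_def lookup_add algebra_simps)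
  qed simp
  then show ?case using single_add by (simp add: pairing_add_left pairing_add_right)
qed simp

lemma pairing_eq_sum:
  "pairing \<Theta> F = (\<Sum>m\<in>Poly_Mapping.keys F. lookup \<Theta> m * diff_coeff m m * lookup F m)"
proof -
  have F: "F = (\<Sum>m\<in>Poly_Mapping.keys F. Poly_Mapping.single m (lookup F m))"
    by (rule poly_mapping_eqI) (simp add: lookup_sum lookup_single when_def in_keys_iff)
  have *: "pairing \<Theta> (sum f A) = (\<Sum>x\<in>A. pairing \<Theta> (f x))" for f :: "'a monom \<Rightarrow> 'a cpoly" and A
    by (induction A rule: infinite_finite_induct) (simp_all add: pairing_add_right)
  have "pairing \<Theta> F = (\<Sum>m\<in>Poly_Mapping.keys F. pairing \<Theta> (Poly_Mapping.single m (lookup F m)))"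
    using arg_cong[OF F, of "pairing \<Theta>"] unfolding * .
  then show ?thesis
    by (simp add: pairing_commute[of \<Theta>] pairing_single mult_ac)
qed

lemma form_0_eq_0:
  fixes P :: "'n::finite cpoly"
  assumes P: "P \<in> forms 0" "lookup P 0 = 0"
  shows "P = 0"
proof (rule poly_mapping_eqI)
  fix m :: "'n monom"
  have "m = 0" if "monom_deg m = 0"
    using that by (rule monom_deg_eq_0)
  moreover have "monom_deg m = 0" if "lookup P m \<noteq> 0"
    using P(1) that by (simp add: forms_def in_keys_iff)
  ultimately show "lookup P m = lookup 0 m"
    using P(2) by (cases "lookup P m = 0") auto
qed

lemma apply_diff_eq_0_iff_pairing:
  assumes "\<Theta> \<in> forms d" "F \<in> forms d"
  shows "apply_diff \<Theta> F = 0 \<longleftrightarrow> pairing \<Theta> F = 0"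
  using form_0_eq_0[of "apply_diff \<Theta> F"] apply_diff_forms[OF assms] by (auto simp: pairing_def)

lemma separating_functional:
  fixes J :: "'n cpoly set"
  assumes "cvs.subspace J" "x \<notin> J"
  obtains g where "Vector_Spaces.linear cscale (*) g" "\<And>y. y \<in> J \<Longrightarrow> g y = 0" "g x = 1"
proof -
  obtain B where B: "B \<subseteq> J" "cvs.independent B" "J \<subseteq> cvs.span B"
    using cvs.maximal_independent_subset[of J] by metis
  have J: "J = cvs.span B"
    using B cvs.span_minimal[OF B(1) assms(1)] by blast
  have ind: "cvs.independent (insert x B)"
    using assms(2) B(2) J by (simp add: cvs.independent_insertI)
  define E where "E = cvs.extend_basis (insert x B)"
  have E: "insert x B \<subseteq> E" "cvs.independent E" "cvs.span E = UNIV"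
    using cvs.extend_basis_superset[OF ind] cvs.independent_extend_basis[OF ind]
      cvs.span_extend_basis[OF ind] by (simp_all add: E_def)
  show ?thesis
  proof
    show "Vector_Spaces.linear cscale (*) (\<lambda>v. cvs.representation E v x)"
      by (rule cvs.linear_representation[OF E(2,3)])
    show "cvs.representation E x x = 1"
      using E(1) cvs.representation_basis[OF E(2), of x] by auto
    fix y assume y: "y \<in> J"
    have "cvs.representation E y = cvs.representation B y"
      using E(1) y J by (intro cvs.representation_extend[OF E(2)]) auto
    moreover have "x \<notin> B" using assms(2) B(1) by blast
    ultimately show "cvs.representation E y x = 0"
      using cvs.representation_ne_zero[of B y x] by auto
  qed
qed

lemma linear_functional_simps:
  assumes "Vector_Spaces.linear cscale (*) g"
  shows "g (x + y) = g x + g y" "g (cscale c x) = c * g x" "g 0 = (0 :: complex)"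
    "g (sum f A) = (\<Sum>a\<in>A. g (f a))"
proof -
  interpret Vector_Spaces.linear cscale "(*)" g by fact
  show "g (x + y) = g x + g y" "g (cscale c x) = c * g x" "g 0 = 0"
    "g (sum f A) = (\<Sum>a\<in>A. g (f a))"
    by (simp_all add: add scale sum)
qed

text \<open>
  The pairing is perfect in degree \<open>d\<close>, so the functional that separates \<open>x\<close> from \<open>J\<close> is the pairing with
  a form.
\<close>

lemma separating_form:
  fixes x :: "'n::finite cpoly"
  assumes "cvs.subspace J" "x \<notin> J" "J \<subseteq> forms d" "x \<in> forms d"
  obtains G where "G \<in> forms d" "\<And>y. y \<in> J \<Longrightarrow> pairing y G = 0" "pairing x G \<noteq> 0"
proof -
  obtain g where g: "Vector_Spaces.linear cscale (*) g" "\<And>y. y \<in> J \<Longrightarrow> g y = 0" "g x = 1"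
    using separating_functional[OF assms(1,2)] by blast
  note gs = linear_functional_simps[OF g(1)]
  define G where "G = (\<Sum>m | monom_deg m = d. Poly_Mapping.single m
     (g (Poly_Mapping.single m 1) / diff_coeff m m) :: 'n cpoly)"
  have lG: "lookup G m = g (Poly_Mapping.single m 1) / diff_coeff m m" if "monom_deg m = d" for m
    using that by (simp add: G_def lookup_sum lookup_single when_def finite_monom_deg)
  have G: "G \<in> forms d"
    unfolding G_def by (intro cvs.subspace_sum subspace_forms) (simp add: forms_def)
  have pg: "pairing y G = g y" if "y \<in> forms d" for y
  proof -
    have y: "y = (\<Sum>m\<in>Poly_Mapping.keys y. cscale (lookup y m) (Poly_Mapping.single m 1))"
      by (rule poly_mapping_eqI)
         (simp add: cscale_single lookup_sum lookup_single when_def in_keys_iff)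
    have "pairing y G = (\<Sum>m\<in>Poly_Mapping.keys y. lookup G m * diff_coeff m m * lookup y m)"
      by (subst pairing_commute) (rule pairing_eq_sum)
    also have "\<dots> = (\<Sum>m\<in>Poly_Mapping.keys y. lookup y m * g (Poly_Mapping.single m 1))"
      using that by (intro sum.cong) (auto simp: lG forms_def diff_coeff_self)
    also have "\<dots> = g y" by (subst (3) y) (simp only: gs)
    finally show ?thesis .
  qed
  show ?thesis
  proof (rule that[OF G])
    show "pairing y G = 0" if "y \<in> J" for y using that pg[of y] g(2) assms(3) by auto
    show "pairing x G \<noteq> 0" using pg[OF assms(4)] g(3) by simp
  qed
qed


section \<open>Equipotent apolar generators and non-scalar matrices\<close>

lemma pderiv_apply_diff: "pderiv_var i (apply_diff \<Theta> F) = apply_diff \<Theta> (pderiv_var i F)"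
  by (metis apply_diff_mult apply_diff_var mult.commute)

lemma apply_diff_cscale_right: "apply_diff \<Theta> (cscale c F) = cscale c (apply_diff \<Theta> F)"
proof -
  have *: "cscale c F = apply_diff (Poly_Mapping.single 0 c) F" for F :: "'a cpoly"
  proof (induction F rule: cpoly_induct)
    case (single_add m a G)
    then show ?case
      by (simp add: cvs.scale_right_distrib apply_diff_add_right apply_diff_single cscale_single diff_coeff_def)
  qed simp
  show ?thesis unfolding * by (metis apply_diff_mult mult.commute)
qed

lemma apply_diff_sum_right: "apply_diff \<Theta> (sum f A) = (\<Sum>x\<in>A. apply_diff \<Theta> (f x))"
  by (induction A rule: infinite_finite_induct) (simp_all add: apply_diff_add_right)

lemma apply_diff_grad_mult: "apply_diff \<Theta> (grad_mult F A k) = grad_mult (apply_diff \<Theta> F) A k"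
  by (simp add: grad_mult_def apply_diff_sum_right apply_diff_cscale_right pderiv_apply_diff)

text \<open>
  If \<open>\<Theta>\<close> annihilates \<open>F\<close>, then \<open>\<alpha>\<^sub>k \<Theta> \<circ> G = \<Theta> \<circ> \<partial>\<^sub>k G\<close> is a combination of the forms
  \<open>\<Theta> \<circ> \<partial>\<^sub>i F = \<partial>\<^sub>i (\<Theta> \<circ> F) = 0\<close>.
\<close>

lemma ideal_mult_subset_apolar_ideal:
  assumes G: "\<And>k. pderiv_var k G = grad_mult F A k"
  shows "ideal_mult max_ideal (apolar_ideal F) \<subseteq> apolar_ideal G"
  unfolding ideal_mult_def
proof (rule module.span_minimal[OF module_mult _ subspace_apolar_ideal])
  let ?S = "{a. \<forall>b\<in>apolar_ideal F. a * b \<in> apolar_ideal G}"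
  have "max_ideal \<subseteq> ?S"
    unfolding max_ideal_def
  proof (rule module.span_minimal[OF module_mult])
    have "apply_diff (var i * b) G = 0" if "apply_diff b F = 0" for i b
    proof -
      have "apply_diff (var i * b) G = apply_diff b (pderiv_var i G)"
        by (metis apply_diff_mult apply_diff_var mult.commute)
      then show ?thesis using that by (simp add: G apply_diff_grad_mult) (simp add: grad_mult_def)
    qed
    then show "range var \<subseteq> ?S" by (auto simp: apolar_ideal_def)
    show "module.subspace (*) ?S"
      by (auto simp: module.subspace_def[OF module_mult] apolar_ideal_def distrib_right
          apply_diff_add_left mult.assoc apply_diff_mult)
  qed
  then show "{a * b |a b. a \<in> max_ideal \<and> b \<in> apolar_ideal F} \<subseteq> apolar_ideal G" by blast
qed

lemma pderiv_zero_imp_zero: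
  assumes "F \<in> forms d" "d > 0" "\<And>k. pderiv_var k F = 0"
  shows "F = 0"
  using euler[OF assms(1)] assms(2,3) by simp

text \<open>
  As \<open>G\<close> is not a multiple of \<open>F\<close>, some operator of degree \<open>d\<close> annihilates \<open>F\<close> but not \<open>G\<close>; all of
  \<open>m F\<^sup>\<bottom>\<close> annihilates \<open>G\<close>.
\<close>

lemma ApoEqu_if_potential:
  fixes F :: "'n::finite cpoly"
  assumes F: "F \<in> forms d" "F \<noteq> 0" and G: "G \<in> forms d" "\<And>k. pderiv_var k G = grad_mult F A k"
    and nF: "\<And>c. G \<noteq> cscale c F"
  shows "F \<in> ApoEqu d"
proof -
  obtain e0 where e0: "lookup F e0 \<noteq> 0"
    using F(2) by (metis lookup_zero poly_mapping_eqI)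
  obtain e1 where e1: "lookup G e1 \<noteq> lookup (cscale (lookup G e0 / lookup F e0) F) e1"
    using nF poly_mapping_eqI by metis
  have deg: "monom_deg e0 = d" "monom_deg e1 = d"
    using e0 e1 F(1) G(1) by (auto simp: forms_def in_keys_iff)
  \<comment> \<open>The combination of the two coefficient functionals at \<open>e1\<close> and \<open>e0\<close> that vanishes on \<open>F\<close>.\<close>
  define \<Theta> where "\<Theta> = Poly_Mapping.single e1 (1 / diff_coeff e1 e1)
    + Poly_Mapping.single e0 (- lookup F e1 / lookup F e0 / diff_coeff e0 e0)"
  have \<Theta>: "\<Theta> \<in> forms d"
    unfolding \<Theta>_def using deg by (intro cvs.subspace_add subspace_forms) (auto simp: forms_def)
  have p: "pairing \<Theta> H = lookup H e1 - lookup F e1 / lookup F e0 * lookup H e0" for H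
    by (simp add: \<Theta>_def pairing_add_left pairing_single diff_coeff_self)
  have "pairing \<Theta> F = 0" using e0 by (simp add: p)
  then have "\<Theta> \<in> apolar_ideal F"
    using apply_diff_eq_0_iff_pairing[OF \<Theta> F(1)] by (simp add: apolar_ideal_def)
  moreover have "pairing \<Theta> G \<noteq> 0" using e0 e1 by (simp add: p field_simps)
  then have "\<Theta> \<notin> apolar_ideal G" by (auto simp: apolar_ideal_def pairing_def)
  then have "\<Theta> \<notin> ideal_mult max_ideal (apolar_ideal F)"
    using ideal_mult_subset_apolar_ideal[OF G(2)] by blast
  ultimately show ?thesis using F(1) \<Theta> by (auto simp: ApoEqu_iff)
qed

text \<open>
  If the derivative of \<open>F\<close> along \<open>v\<close> vanishes, then \<open>F\<close> is invariant under the projection \<open>M\<close> along \<open>v\<close>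
  to a coordinate hyperplane, so it is a form in the linear forms that vanish on \<open>v\<close>.
\<close>

lemma nonconcise_if_directional_zero:
  fixes F :: "'n::finite cpoly"
  assumes F: "F \<in> forms d" and v: "v \<noteq> 0" "(\<Sum>i\<in>UNIV. cscale (v $ i) (pderiv_var i F)) = 0"
  shows "F \<notin> Con d"
proof -
  obtain i0 where i0: "v $ i0 \<noteq> 0" using v(1) by (auto simp: vec_eq_iff)
  \<comment> \<open>\<open>W E\<close> sends \<open>u\<close> to \<open>- (u\<^sub>i / v\<^sub>i) v\<close> for \<open>i = i0\<close>, so \<open>M\<close> moves \<open>u\<close> along \<open>v\<close> until
    coordinate \<open>i0\<close> vanishes.\<close>
  define W :: "complex^'n^'n" where "W = (\<chi> i k. v $ i)"
  define E :: "complex^'n^'n" where "E = (\<chi> k j. if k = i0 \<and> j = i0 then - 1 / v $ i0 else 0)"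
  define M where "M = mat 1 + W ** E"
  have "grad_mult F W k = 0" for k using v(2) by (simp add: grad_mult_def W_def)
  from lin_subst_shift[OF this, of "mat 1" E] have "lin_subst M F = F" by (simp add: M_def)
  then have S: "F \<in> Sym d (row_space M)" using lin_subst_in_Sym[OF F, of M] by simp
  have "M *v v = 0"
  proof -
    have "(W ** E) $ i $ j = (if j = i0 then - (v $ i / v $ i0) else 0)" for i j
    proof -
      have "(W ** E) $ i $ j = (\<Sum>k\<in>UNIV. if k = i0 then (if j = i0 then - (v $ i / v $ i0) else 0) else 0)"
        unfolding matrix_matrix_mult_def W_def E_def vec_lambda_beta
        by (intro sum.cong) auto
      then show ?thesis by simp
    qed
    then have "((W ** E) *v v) $ i = - (v $ i)" for i
      using i0 by (simp add: matrix_vector_mult_def if_distrib[of "\<lambda>x. x * _"] cong: if_cong)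
    then have "(W ** E) *v v = - v" by (simp add: vec_eq_iff)
    then show ?thesis by (simp add: M_def matrix_vector_mult_add_rdistrib)
  qed
  have "row_space M \<noteq> linear_forms"
  proof
    assume "row_space M = linear_forms"
    then have "lin (axis i0 1) \<in> row_space M" by (simp only: linear_forms_eq rangeI)
    then obtain a where a: "axis i0 1 = a v* M" by (auto simp: row_space_def simp del: lin_axis)
    \<comment> \<open>The coordinate form \<open>i0\<close> does not vanish on \<open>v\<close>, whereas every row of \<open>M\<close> does.\<close>
    have "(\<Sum>j\<in>UNIV. axis i0 1 $ j * v $ j) = (\<Sum>j\<in>UNIV. \<Sum>i\<in>UNIV. a $ i * (M $ i $ j * v $ j))"
      by (simp add: a vector_matrix_mult_def sum_distrib_left mult_ac)
    also have "\<dots> = (\<Sum>i\<in>UNIV. a $ i * (M *v v) $ i)"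
      by (subst sum.swap) (simp add: matrix_vector_mult_def sum_distrib_left)
    also have "\<dots> = 0" by (simp add: \<open>M *v v = 0\<close>)
    finally show False
      using i0 by (simp add: axis_def if_distrib[of "\<lambda>x. x * _"] cong: if_cong)
  qed
  moreover have "row_space M \<subseteq> linear_forms" by (auto simp: row_space_def linear_forms_eq)
  ultimately show ?thesis using S subspace_row_space by (auto simp: Con_def)
qed

text \<open>
  If the potential \<open>G\<close> of \<open>A\<^sup>T \<nabla>F\<close> were \<open>c F\<close>, every column of \<open>A - c\<close> would be a direction in which the
  derivative of \<open>F\<close> vanishes. Conciseness leaves only the column \<open>0\<close>, but \<open>A \<noteq> c\<close>.
\<close>

theorem concise_nonscalar_ApoEqu:
  fixes F :: "'n::finite cpoly"
  assumes F: "F \<in> Con d" "d > 0" "F \<noteq> 0" and A: "A \<in> sym_mats F" "\<And>c. A \<noteq> mat c"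
  shows "F \<in> ApoEqu d"
proof -
  have Ff: "F \<in> forms d" using F(1) by (simp add: Con_def)
  obtain G where G: "G \<in> forms d" "\<And>k. pderiv_var k G = grad_mult F A k"
    using potential_exists[OF Ff F(2) A(1)] by blast
  have "G \<noteq> cscale c F" for c
  proof
    assume Gc: "G = cscale c F"
    have "A - mat c \<noteq> 0" using A(2) by simp
    then obtain i k where ik: "(A - mat c) $ i $ k \<noteq> 0" by (auto simp: vec_eq_iff)
    define v where "v = (\<chi> i. (A - mat c) $ i $ k)"
    have "v \<noteq> 0" using ik by (auto simp: v_def vec_eq_iff)
    moreover have "(\<Sum>i\<in>UNIV. cscale (v $ i) (pderiv_var i F)) = grad_mult F A k - grad_mult F (mat c) k"
      by (simp add: v_def grad_mult_def cvs.scale_left_diff_distrib sum_subtractf)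
    then have "(\<Sum>i\<in>UNIV. cscale (v $ i) (pderiv_var i F)) = 0"
      by (simp add: grad_mult_mat Gc pderiv_var_cscale flip: G(2))
    ultimately show False using nonconcise_if_directional_zero[OF Ff] F(1) by blast
  qed
  then show ?thesis by (intro ApoEqu_if_potential[OF Ff F(3) G])
qed

text \<open>
  Separating the generator \<open>\<Theta>\<close> from the degree \<open>d\<close> part of \<open>m F\<^sup>\<bottom>\<close> gives \<open>G\<close>. If a derivative of \<open>G\<close> were not in
  the span of those of \<open>F\<close>, then some \<open>b\<close> of degree \<open>d - 1\<close> would be orthogonal to the latter, which puts \<open>b\<close>
  into \<open>F\<^sup>\<bottom>\<close>, but not to the former, so that \<open>\<alpha>\<^sub>k b\<close> would not annihilate \<open>G\<close>. The matrix is not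
  scalar because \<open>\<Theta>\<close> annihilates \<open>F\<close> but not \<open>G\<close>.
\<close>

lemma ApoEqu_nonscalar:
  fixes F :: "'n::finite cpoly"
  assumes F: "F \<in> ApoEqu d" and d: "d > 0"
  obtains A where "A \<in> sym_mats F" "\<And>c. A \<noteq> mat c"
proof -
  let ?I = "ideal_mult max_ideal (apolar_ideal F)"
  from F obtain \<Theta> where Ff: "F \<in> forms d" and \<Theta>: "\<Theta> \<in> apolar_ideal F" "\<Theta> \<in> forms d" "\<Theta> \<notin> ?I"
    by (auto simp: ApoEqu_iff)
  have sI: "module.subspace (*) ?I"
    unfolding ideal_mult_def by (rule module.subspace_span[OF module_mult])
  have "cvs.subspace (?I \<inter> forms d)"
  proof (intro cvs.subspace_inter subspace_forms cvs.subspaceI)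
    show "cscale c x \<in> ?I" if "x \<in> ?I" for c x
      unfolding cscale_def by (rule module.subspace_scale[OF module_mult sI that])
  qed (simp_all add: module.subspace_0[OF module_mult sI] module.subspace_add[OF module_mult sI])
  from separating_form[OF this _ Int_lower2 \<Theta>(2)] \<Theta>(3)
  obtain G where G: "G \<in> forms d" "\<And>y. y \<in> ?I \<inter> forms d \<Longrightarrow> pairing y G = 0" "pairing \<Theta> G \<noteq> 0"
    by (metis Int_iff)
  let ?S = "range (\<lambda>a :: complex^'n. \<Sum>i\<in>UNIV. cscale (a $ i) (pderiv_var i F))"
  have sub: "cvs.subspace ?S"
  proof (rule cvs.subspaceI)
    show "0 \<in> ?S" by (rule range_eqI[of _ _ 0]) simp
  next
    fix x y assume "x \<in> ?S" "y \<in> ?S"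
    then obtain a b :: "complex^'n" where "x = (\<Sum>i\<in>UNIV. cscale (a $ i) (pderiv_var i F))"
      "y = (\<Sum>i\<in>UNIV. cscale (b $ i) (pderiv_var i F))" by auto
    then show "x + y \<in> ?S"
      by (intro range_eqI[of _ _ "a + b"]) (simp add: cvs.scale_left_distrib sum.distrib)
  next
    fix c x assume "x \<in> ?S"
    then obtain a :: "complex^'n" where "x = (\<Sum>i\<in>UNIV. cscale (a $ i) (pderiv_var i F))" by auto
    then show "cscale c x \<in> ?S"
      by (intro range_eqI[of _ _ "c *s a"]) (simp add: cvs.scale_sum_right)
  qed
  have "pderiv_var k G \<in> ?S" for k
  proof (rule ccontr)
    assume "pderiv_var k G \<notin> ?S"
    moreover have "?S \<subseteq> forms (d - 1)"
      by (intro image_subsetI cvs.subspace_sum cvs.subspace_scale subspace_forms pderiv_var_forms Ff)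
    ultimately obtain b where b: "b \<in> forms (d - 1)" "\<And>y. y \<in> ?S \<Longrightarrow> pairing y b = 0"
      "pairing (pderiv_var k G) b \<noteq> 0"
      using separating_form[OF sub _ _ pderiv_var_forms[OF G(1)]] by blast
    have "pderiv_var j F \<in> ?S" for j
    proof (rule range_eqI[of _ _ "axis j 1"])
      have "(\<Sum>i\<in>UNIV. cscale (axis j 1 $ i) (pderiv_var i F))
          = (\<Sum>i\<in>UNIV. if i = j then pderiv_var i F else 0)"
        by (intro sum.cong) (auto simp: axis_def)
      then show "pderiv_var j F = (\<Sum>i\<in>UNIV. cscale (axis j 1 $ i) (pderiv_var i F))" by simp
    qed
    then have "pairing b (pderiv_var j F) = 0" for j
      using b(2) by (simp add: pairing_commute[of b])
    then have "apply_diff b (pderiv_var j F) = 0" for j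
      using apply_diff_eq_0_iff_pairing[OF b(1) pderiv_var_forms[OF Ff]] by blast
    then have "pderiv_var j (apply_diff b F) = 0" for j by (simp add: pderiv_apply_diff)
    moreover have "apply_diff b F \<in> forms 1"
      using apply_diff_forms[OF b(1) Ff] d by simp
    ultimately have "apply_diff b F = 0"
      by (metis pderiv_zero_imp_zero zero_less_one)
    then have "b \<in> apolar_ideal F" by (simp add: apolar_ideal_def)
    moreover have "var k \<in> max_ideal"
      unfolding max_ideal_def by (rule module.span_base[OF module_mult rangeI])
    ultimately have "var k * b \<in> ?I"
      unfolding ideal_mult_def by (intro module.span_base[OF module_mult]) blast
    moreover have "var k * b \<in> forms (1 + (d - 1))"
      using linear_forms_subset b(1)
      by (intro forms_mult) (auto simp: linear_forms_def intro: cvs.span_base)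
    ultimately have "pairing (var k * b) G = 0" using G(2) d by simp
    moreover have "pairing (var k * b) G = pairing b (pderiv_var k G)"
      by (metis apply_diff_mult apply_diff_var mult.commute pairing_def)
    ultimately show False using b(3) by (simp add: pairing_commute)
  qed
  then have "\<exists>a :: complex^'n. pderiv_var k G = (\<Sum>i\<in>UNIV. cscale (a $ i) (pderiv_var i F))" for k
    by auto
  then obtain a :: "'n \<Rightarrow> complex^'n" where
    a: "\<And>k. pderiv_var k G = (\<Sum>i\<in>UNIV. cscale (a k $ i) (pderiv_var i F))" by metis
  define A where "A = (\<chi> i k. a k $ i)"
  have A: "pderiv_var k G = grad_mult F A k" for k by (simp add: a A_def grad_mult_def)
  have "A \<noteq> mat c" for c
  proof
    assume "A = mat c"
    then have "pderiv_var k (G - cscale c F) = 0" for k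
      by (simp add: pderiv_var_minus A grad_mult_mat pderiv_var_cscale)
    moreover have "G - cscale c F \<in> forms d"
      by (intro cvs.subspace_diff subspace_forms cscale_const_forms G(1) Ff)
    ultimately have "G - cscale c F = 0"
      by (metis pderiv_zero_imp_zero d)
    then have "pairing \<Theta> G = 0"
      using \<Theta>(1) by (simp add: pairing_def apply_diff_cscale_right apolar_ideal_def)
    then show False using G(3) by simp
  qed
  then show ?thesis using that sym_mats_if_potential[OF A] by blast
qed


section \<open>From limits of direct sums to non-scalar matrices\<close>

lemma grad_mult_add: "grad_mult (F + G) A k = grad_mult F A k + grad_mult G A k"
  by (simp add: grad_mult_def pderiv_var_add cvs.scale_right_distrib sum.distrib)

lemma grad_mult_cscale: "grad_mult (cscale c F) A k = cscale c (grad_mult F A k)"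
  by (simp add: grad_mult_def pderiv_var_cscale cvs.scale_sum_right mult.commute)

lemma grad_mult_mult: "grad_mult (F * G) A k = grad_mult F A k * G + F * grad_mult G A k"
  by (simp add: grad_mult_def pderiv_var_mult cvs.scale_right_distrib sum.distrib
      sum_distrib_left sum_distrib_right cscale_mult_left cscale_mult_right)

lemma grad_mult_lin: "grad_mult (lin v) A k = Poly_Mapping.single 0 ((v v* A) $ k)"
  by (rule poly_mapping_eqI)
     (simp add: grad_mult_def lookup_sum pderiv_var_lin lookup_single when_def vector_matrix_mult_def mult.commute)

text \<open>
  Both sides are derivations in \<open>F\<close>, so it suffices to compare them on the generators \<open>V\<close>.
\<close>

lemma grad_mult_Sym:
  assumes F: "F \<in> Sym d V" and V: "\<And>x. x \<in> V \<Longrightarrow> grad_mult x A k = cscale c (pderiv_var k x)"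
  shows "grad_mult F A k = cscale c (pderiv_var k F)"
proof -
  have prod: "grad_mult (\<Prod>i<n. l i) A k = cscale c (pderiv_var k (\<Prod>i<n. l i))"
    if "\<forall>i<n. l i \<in> V" for l and n :: nat
    using that
  proof (induction n)
    case 0
    have "pderiv_var i (1 :: 'a cpoly) = 0" for i using pderiv_var_const[of i 1] by simp
    then show ?case by (simp add: grad_mult_def)
  next
    case (Suc n)
    then show ?case
      by (simp add: grad_mult_mult pderiv_var_mult V cscale_mult_left cscale_mult_right cvs.scale_right_distrib)
  qed
  show ?thesis
    using F unfolding Sym_def
  proof (induction F rule: cvs.span_induct_alt)
    case base
    then show ?case by (simp add: grad_mult_def)
  next
    case (step a x y)
    then show ?case
      by (auto simp: grad_mult_add grad_mult_cscale prod pderiv_var_add pderiv_var_cscale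
          cvs.scale_right_distrib mult.commute)
  qed
qed

text \<open>
  Let \<open>P\<close> be the projection onto \<open>V\<^sub>1\<close> along \<open>V\<^sub>2\<close>. Then \<open>P\<^sup>T \<nabla>F = \<nabla>F\<^sub>1\<close>, which is a gradient; and \<open>P\<close> is
  not scalar since neither \<open>V\<^sub>1\<close> nor \<open>V\<^sub>2\<close> is zero.
\<close>

lemma DirSum_nonscalar:
  fixes F :: "'n::finite cpoly"
  assumes F: "F \<in> DirSum d" and d: "d > 0"
  obtains A where "A \<in> sym_mats F" "\<And>c. A \<noteq> mat c"
proof -
  obtain V1 V2 F1 F2 where V: "direct_decomp V1 V2" and F12: "F1 \<in> Sym d V1" "F1 \<noteq> 0"
    "F2 \<in> Sym d V2" "F2 \<noteq> 0" "F = F1 + F2"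
    using F by (auto simp: DirSum_def)
  have sV: "cvs.subspace V1" "cvs.subspace V2" "V1 \<inter> V2 = {0}"
    and sum: "{a + b |a b. a \<in> V1 \<and> b \<in> V2} = linear_forms"
    using V by (auto simp: direct_decomp_def)
  note sub = direct_decomp_subset[OF V]
  have "\<exists>p. lin p \<in> V1 \<and> var i - lin p \<in> V2" for i
  proof -
    have "var i \<in> {a + b |a b. a \<in> V1 \<and> b \<in> V2}"
      unfolding sum by (simp add: linear_forms_def cvs.span_base)
    then obtain a b where ab: "var i = a + b" "a \<in> V1" "b \<in> V2" by blast
    moreover obtain p where "a = lin p" using ab(2) sub(1) linear_forms_eq by blast
    ultimately show ?thesis by (intro exI[of _ p]) simp
  qed
  then obtain p where p: "\<And>i. lin (p i) \<in> V1" "\<And>i. var i - lin (p i) \<in> V2" by metis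
  define P where "P = (\<chi> i. p i)"
  have PV1: "lin (v v* P) \<in> V1" and PV2: "lin v - lin (v v* P) \<in> V2" for v
  proof -
    have e: "lin (v v* P) = (\<Sum>i\<in>UNIV. cscale (v $ i) (lin (p i)))"
    proof -
      have "v v* P = (\<Sum>i\<in>UNIV. v $ i *s p i)"
        by (simp add: vec_eq_iff vector_matrix_mult_def P_def mult.commute)
      then show ?thesis by (simp add: lin_sum lin_scale)
    qed
    show "lin (v v* P) \<in> V1"
      unfolding e by (intro cvs.subspace_sum cvs.subspace_scale sV p)
    have "lin v - lin (v v* P) = (\<Sum>i\<in>UNIV. cscale (v $ i) (var i - lin (p i)))"
      unfolding e by (simp add: lin_def sum_subtractf cvs.scale_right_diff_distrib)
    also have "\<dots> \<in> V2"
      by (intro cvs.subspace_sum cvs.subspace_scale sV p)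
    finally show "lin v - lin (v v* P) \<in> V2" .
  qed
  have P1: "v v* P = v" if "lin v \<in> V1" for v
  proof -
    have "lin v - lin (v v* P) \<in> V1 \<inter> V2"
      using PV1[of v] PV2[of v] that cvs.subspace_diff[OF sV(1)] by blast
    then have "lin v - lin (v v* P) = 0" using sV(3) by blast
    then show ?thesis by simp
  qed
  have P2: "v v* P = 0" if "lin v \<in> V2" for v
  proof -
    have "lin v - (lin v - lin (v v* P)) \<in> V2" using PV2 that sV by (blast intro: cvs.subspace_diff)
    then have "lin (v v* P) \<in> V1 \<inter> V2" using PV1 by simp
    then have "lin (v v* P) = 0" using sV(3) by blast
    then show ?thesis by simp
  qed
  have g1: "grad_mult F1 P k = cscale 1 (pderiv_var k F1)" for k
  proof (rule grad_mult_Sym[OF F12(1)])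
    fix x assume "x \<in> V1"
    moreover from this obtain v where "x = lin v" using sub(1) linear_forms_eq by blast
    ultimately show "grad_mult x P k = cscale 1 (pderiv_var k x)"
      using P1 by (simp add: grad_mult_lin pderiv_var_lin)
  qed
  have g2: "grad_mult F2 P k = cscale 0 (pderiv_var k F2)" for k
  proof (rule grad_mult_Sym[OF F12(3)])
    fix x assume "x \<in> V2"
    moreover from this obtain v where "x = lin v" using sub(2) linear_forms_eq by blast
    ultimately show "grad_mult x P k = cscale 0 (pderiv_var k x)"
      using P2 by (simp add: grad_mult_lin)
  qed
  have "pderiv_var k F1 = grad_mult F P k" for k
    by (simp add: F12(5) grad_mult_add g1 g2)
  then have "P \<in> sym_mats F" by (rule sym_mats_if_potential)
  moreover have "P \<noteq> mat c" for c
  proof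
    assume Pc: "P = mat c"
    have vc: "v v* P = c *s v" for v
    proof -
      have "(v v* P) $ j = (\<Sum>i\<in>UNIV. if i = j then c * v $ j else 0)" for j
        unfolding vector_matrix_mult_def Pc vec_lambda_beta by (intro sum.cong) (auto simp: mat_def)
      then show ?thesis by (simp add: vec_eq_iff)
    qed
    show False
    proof (cases "c = 0")
      case True
      have "x = 0" if x: "x \<in> V1" for x
      proof -
        obtain v where "x = lin v" using x sub(1) linear_forms_eq by blast
        then show ?thesis using P1[of v] x by (simp add: vc True)
      qed
      then have "V1 \<subseteq> {0}" by blast
      then have "F1 = 0" using F12(1) Sym_mono[of V1 "{0}"] Sym_singleton_0[OF d] by blast
      then show False using F12(2) by simp
    next
      case False
      have "x = 0" if x: "x \<in> V2" for x
      proof -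
        obtain v where "x = lin v" using x sub(2) linear_forms_eq by blast
        then show ?thesis using P2[of v] x False by (simp add: vc)
      qed
      then have "V2 \<subseteq> {0}" by blast
      then have "F2 = 0" using F12(3) Sym_mono[of V2 "{0}"] Sym_singleton_0[OF d] by blast
      then show False using F12(4) by simp
    qed
  qed
  ultimately show ?thesis using that by blast
qed

lemma sym_mats_diff_mat_scaleR:
  assumes "A \<in> sym_mats F"
  shows "A - mat c \<in> sym_mats F" "r *\<^sub>R A \<in> sym_mats F"
proof -
  have "transpose (A - mat c) = transpose A - mat c"
    by (simp add: vec_eq_iff transpose_def mat_def)
  then show "A - mat c \<in> sym_mats F"
    using assms by (simp add: sym_mats_def matrix_diff_ldistrib matrix_diff_rdistrib mult_mat_commute)
  have "r *\<^sub>R A = mat (of_real r) ** A"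
    by (simp add: vec_eq_iff mat_mult_component) (simp add: scaleR_conv_of_real)
  then show "r *\<^sub>R A \<in> sym_mats F"
    using sym_mats_scale[OF assms] by simp
qed

text \<open>
  A scalar matrix of trace \<open>0\<close> vanishes. So these two normalizations, which pass to limits, keep a limit
  from being scalar.
\<close>

lemma normalized_nonscalar:
  fixes F :: "'n::finite cpoly"
  assumes A: "A \<in> sym_mats F" "\<And>c. A \<noteq> mat c"
  obtains B where "B \<in> sym_mats F" "norm B = 1" "trace B = 0"
proof -
  define c where "c = trace A / of_nat CARD('n)"
  define C where "C = A - mat c"
  have "trace (mat c :: complex^'n^'n) = of_nat CARD('n) * c" by (simp add: trace_def mat_def)
  then have t: "trace C = 0" by (simp add: C_def trace_sub c_def)
  have C: "C \<noteq> 0" using A(2) by (simp add: C_def)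
  show ?thesis
  proof
    show "inverse (norm C) *\<^sub>R C \<in> sym_mats F"
      unfolding C_def by (intro sym_mats_diff_mat_scaleR A)
    show "norm (inverse (norm C) *\<^sub>R C) = 1" using C by simp
    have "trace (inverse (norm C) *\<^sub>R C) = inverse (norm C) *\<^sub>R trace C"
      by (simp add: trace_def scaleR_sum_right)
    then show "trace (inverse (norm C) *\<^sub>R C) = 0" by (simp add: t)
  qed
qed

text \<open>
  The normalized matrices of a convergent sequence of direct sums accumulate on the unit sphere, and the
  equation \<open>A\<^sup>T H = H A\<close> is continuous in \<open>A\<close> and in the coefficients of \<open>F\<close>.
\<close>

theorem closure_DirSum_nonscalar:
  fixes F :: "'n::finite cpoly"
  assumes F: "F \<in> closure (DirSum d)" and d: "d > 0"
  obtains A where "A \<in> sym_mats F" "\<And>c. A \<noteq> mat c"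
proof -
  obtain f where f: "\<And>n. f n \<in> DirSum d" "f \<longlonglongrightarrow> F"
    using F by (auto simp: closure_sequential)
  have "\<exists>B. B \<in> sym_mats (f n) \<and> norm B = 1 \<and> trace B = 0" for n
    using DirSum_nonscalar[OF f(1) d] normalized_nonscalar by metis
  then obtain B where B: "\<And>n. B n \<in> sym_mats (f n)" "\<And>n. norm (B n) = 1" "\<And>n. trace (B n) = 0"
    by metis
  have "seq_compact (sphere 0 1 :: (complex^'n^'n) set)"
    by (simp add: compact_imp_seq_compact)
  then obtain A r where A: "A \<in> sphere 0 1" "strict_mono r" "(B \<circ> r) \<longlonglongrightarrow> A"
    using B(2) unfolding seq_compact_def by (metis mem_sphere_0)
  have Bl: "(\<lambda>n. B (r n) $ i $ j) \<longlonglongrightarrow> A $ i $ j" for i j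
    using A(3) by (intro tendsto_vec_nth) (simp add: o_def)
  have "(\<lambda>n. f (r n)) \<longlonglongrightarrow> F"
    using LIMSEQ_subseq_LIMSEQ[OF f(2) A(2)] by (simp add: o_def)
  then have "(\<lambda>n. lookup (f (r n)) m) \<longlonglongrightarrow> lookup F m" for m
    by (rule metric_tendsto_imp_tendsto) (simp add: dist_lookup_le)
  then have Hl: "(\<lambda>n. hess (f (r n)) m $ i $ j) \<longlonglongrightarrow> hess F m $ i $ j" for m i j
    by (auto simp: hess_def lookup_pderiv_var intro!: tendsto_intros)
  have "A \<in> sym_mats F"
    unfolding sym_mats_def
  proof (intro CollectI allI)
    fix m
    have "(transpose A ** hess F m) $ i $ j = (hess F m ** A) $ i $ j" for i j
    proof (rule LIMSEQ_unique)
      show "(\<lambda>n. (transpose (B (r n)) ** hess (f (r n)) m) $ i $ j) \<longlonglongrightarrow> (transpose A ** hess F m) $ i $ j"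
        by (auto simp: matrix_matrix_mult_def transpose_def intro!: tendsto_intros Bl Hl)
      have "(\<lambda>n. (hess (f (r n)) m ** B (r n)) $ i $ j) \<longlonglongrightarrow> (hess F m ** A) $ i $ j"
        by (auto simp: matrix_matrix_mult_def intro!: tendsto_intros Bl Hl)
      then show "(\<lambda>n. (transpose (B (r n)) ** hess (f (r n)) m) $ i $ j) \<longlonglongrightarrow> (hess F m ** A) $ i $ j"
        using B(1) by (simp add: sym_mats_def)
    qed
    then show "transpose A ** hess F m = hess F m ** A" by (simp add: vec_eq_iff)
  qed
  moreover have "A \<noteq> mat c" for c
  proof
    assume Ac: "A = mat c"
    have "(\<lambda>n. trace (B (r n))) \<longlonglongrightarrow> trace A"
      unfolding trace_def by (intro tendsto_intros Bl)
    then have "trace A = 0" using B(3) by (simp add: LIMSEQ_const_iff)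
    then have "c = 0" by (simp add: Ac trace_def mat_def)
    then show False using A(1) Ac by simp
  qed
  ultimately show ?thesis using that by blast
qed

lemma Con_nonzero:
  fixes F :: "'n::finite cpoly"
  assumes "F \<in> Con d"
  shows "F \<noteq> 0"
proof
  assume "F = 0"
  moreover have "0 \<in> Sym d {0 :: 'n cpoly}" by (intro cvs.subspace_0 subspace_Sym)
  moreover have "{0} \<subseteq> (linear_forms :: 'n cpoly set)" by (simp add: linear_forms_def cvs.span_zero)
  ultimately have "linear_forms = {0 :: 'n cpoly}"
    using assms cvs.subspace_single_0 unfolding Con_def by blast
  then have "lin (axis i 1 :: complex^'n) = 0" for i :: 'n
    unfolding linear_forms_eq by blast
  from this[of undefined] show False by (simp only: lin_eq_0_iff axis_eq_0_iff) simp
qed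

theorem theorem1p7:
  fixes d :: nat
  assumes "CARD('n::finite) \<ge> 2" and "d \<ge> 3"
  shows "(\<forall>F \<in> (ApoEqu d :: 'n cpoly set). F \<in> closure (DirSum d)) \<and>
         (\<forall>F \<in> (Con d :: 'n cpoly set). F \<in> closure (DirSum d) \<longrightarrow> F \<in> ApoEqu d) \<and>
         ApoEqu d \<inter> Con d = closure (DirSum d) \<inter> (Con d :: 'n cpoly set)"
proof -
  have d: "d > 0" using assms(2) by simp
  have 1: "F \<in> closure (DirSum d)" if F: "F \<in> ApoEqu d" for F :: "'n cpoly"
  proof -
    have "F \<in> forms d" using F by (simp add: ApoEqu_def)
    then show ?thesis using nonscalar_in_closure[OF _ d] ApoEqu_nonscalar[OF F d] by metis
  qed
  have 2: "F \<in> ApoEqu d" if "F \<in> Con d" "F \<in> closure (DirSum d)" for F :: "'n cpoly"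
    using concise_nonscalar_ApoEqu[OF that(1) d Con_nonzero[OF that(1)]]
      closure_DirSum_nonscalar[OF that(2) d] by metis
  show ?thesis using 1 2 by blast
qed


end
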